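(* Let $Q\subset\mathbb{R}^2$ be the regular hexagon of unit width (euclidean distance $1$ between opposite sides), and let $K$ be any $Q$-cover. Then $\operatorname{area}K\ge\operatorname{area}K_0=\frac{1}{2\operatorname{area}Q}$, where $K_0$ is the regular triangle of unit height whose sides are parallel to sides of $Q$.
   Context: For $x\in\mathbb{R}^2$ let $\|x\|_Q=\max_{y\in Q}\langle x,y\rangle$ (one may take $Q$ centered at the origin). A non-degenerate triangle is $Q$-normal if its boundary can be oriented $u\to v\to w\to u$ so that the directions of $v-u$, $w-v$, $u-w$ are outward normal directions of sides of $Q$ and $\|v-u\|_Q+\|w-v\|_Q+\|u-w\|_Q=1$; a segment $[u,v]$ is $Q$-normal if the directions of $v-u$ and $u-v$ are outward normal directions of sides of $Q$ and $\|v-u\|_Q+\|u-v\|_Q=1$. A set $A$ fits into $B$ if $A+t\subset B$ for some $t$. A $Q$-cover is a convex shape (compact convex set with non-empty interior) into which every $Q$-normal triangle (degenerate or not) fits. *)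

theory Defs
  imports "HOL-Analysis.Analysis"
begin

definition Qnorm :: "(real^2) set \<Rightarrow> real^2 \<Rightarrow> real" where
  "Qnorm Q x = (SUP y\<in>Q. x \<bullet> y)"

definition side_normal :: "(real^2) set \<Rightarrow> real^2 \<Rightarrow> bool" where
  "side_normal Q d \<longleftrightarrow> d \<noteq> 0 \<and> aff_dim {y \<in> Q. d \<bullet> y = Qnorm Q d} = 1"

definition Q_normal_triangle :: "(real^2) set \<Rightarrow> (real^2) set \<Rightarrow> bool" where
  "Q_normal_triangle Q T \<longleftrightarrow>
     (\<exists>u v w. T = convex hull {u, v, w} \<and> \<not> collinear {u, v, w} \<and>
        side_normal Q (v - u) \<and> side_normal Q (w - v) \<and> side_normal Q (u - w) \<and>
        Qnorm Q (v - u) + Qnorm Q (w - v) + Qnorm Q (u - w) = 1)"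

definition Q_normal_segment :: "(real^2) set \<Rightarrow> (real^2) set \<Rightarrow> bool" where
  "Q_normal_segment Q T \<longleftrightarrow>
     (\<exists>u v. T = closed_segment u v \<and>
        side_normal Q (v - u) \<and> side_normal Q (u - v) \<and>
        Qnorm Q (v - u) + Qnorm Q (u - v) = 1)"

definition fits_into :: "(real^2) set \<Rightarrow> (real^2) set \<Rightarrow> bool" where
  "fits_into A B \<longleftrightarrow> (\<exists>t. (\<lambda>x. x + t) ` A \<subseteq> B)"

definition Q_cover :: "(real^2) set \<Rightarrow> (real^2) set \<Rightarrow> bool" where
  "Q_cover Q K \<longleftrightarrow> convex K \<and> compact K \<and> interior K \<noteq> {} \<and>
     (\<forall>T. (Q_normal_triangle Q T \<or> Q_normal_segment Q T) \<longrightarrow> fits_into T K)"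

text \<open>Regular hexagon of unit width centred at the origin, rotated by angle \<theta>:
  circumradius 1/sqrt 3, vertices at angles \<theta> + k pi/3.\<close>
definition hexagon :: "real \<Rightarrow> (real^2) set" where
  "hexagon \<theta> = convex hull {vector [cos (\<theta> + real k * pi / 3) / sqrt 3,
                                     sin (\<theta> + real k * pi / 3) / sqrt 3] | k::nat. k < 6}"

text \<open>Regular triangle of unit height (circumradius 2/3) with sides parallel to the
  sides of hexagon \<theta> (side normals at \<theta> + pi/6 + 2k pi/3).\<close>
definition triangle0 :: "real \<Rightarrow> (real^2) set" where
  "triangle0 \<theta> = convex hull {vector [2/3 * cos (\<theta> - pi/6 + real k * 2 * pi / 3),
                                       2/3 * sin (\<theta> - pi/6 + real k * 2 * pi / 3)] | k::nat. k < 3}"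

end

theory Submission
  imports Defs
begin

text \<open>
  In suitable affine coordinates a cover is a compact convex set \<open>K\<close> containing translates of two
  opposite right triangles with legs 2/3 and of three segments parallel to their sides; the
  claim becomes that the area of \<open>K\<close> is at least 2/3. The area of \<open>K\<close> is bounded
  below by signed areas of closed polygons with vertices in \<open>K\<close>: by Fubini such a polygon need not be
  simple, it suffices that some linear functional increases and then decreases along it.

  Let \<open>l1\<close>, \<open>l2\<close>, \<open>l3\<close> be the linear functionals with sum 0 that vanish on the three segment
  directions. If the maxima of \<open>l1\<close>, \<open>l2\<close>, \<open>l3\<close> over \<open>K\<close> have sum at least 2, a hexagon formed by the
  vertices of a triangle and three support points suffices; if some \<open>lk\<close> has range of length at
  least 4/3, a quadrilateral with the k-th segment as diagonal suffices. Otherwise either the hexagon of the six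
  segment endpoints is large enough, or it can be enlarged by the vertices of one triangle to a nonagon
  that is, and on which some \<open>lk\<close> is unimodal.
\<close>

section \<open>Signed areas of unimodal polygons\<close>

lemma vector_2_eq_axes: "(vector [x, y] :: real^2) = x *\<^sub>R axis 1 1 + y *\<^sub>R axis 2 1"
  by (simp add: vec_eq_iff forall_2 axis_def)

lemma borel_measurable_vector_2:
  "(\<lambda>p::real\<times>real. vector [fst p, snd p] :: real^2) \<in> borel_measurable borel"
  unfolding vector_2_eq_axes by (intro borel_measurable_continuous_onI continuous_intros)

text \<open>Fubini is available for pairs of reals; this measure-preserving identification carries
  it over to \<open>real^2\<close>. It suffices to compare the measures of boxes.\<close>

lemma distr_vector_2_lborel:
  "distr (lborel :: (real \<times> real) measure) borel (\<lambda>p. vector [fst p, snd p]) = (lborel :: (real^2) measure)"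
proof (rule lborel_eqI[symmetric])
  note m = borel_measurable_vector_2
  fix l u :: "real^2"
  assume lu: "\<And>b. b \<in> Basis \<Longrightarrow> l \<bullet> b \<le> u \<bullet> b"
  then have lu': "l $ i \<le> u $ i" for i
    using lu[of "axis i 1"] by (simp add: axis_in_Basis_iff inner_axis)
  have vi: "(\<lambda>p::real\<times>real. vector [fst p, snd p] :: real^2) -` box l u = box (l$1, l$2) (u$1, u$2)"
    by (auto simp: box_def Basis_prod_def axis_eq_axis Basis_vec_def inner_axis forall_2)
  have "emeasure (distr (lborel :: (real \<times> real) measure) borel (\<lambda>p. vector [fst p, snd p])) (box l u)
      = emeasure (lborel :: (real \<times> real) measure) (box (l$1, l$2) (u$1, u$2))"
    using m by (subst emeasure_distr) (auto simp: vi)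
  also have "\<dots> = ennreal ((u$1 - l$1) * (u$2 - l$2))"
    using lu' by (subst emeasure_lborel_box) (auto simp: Basis_prod_def prod.union_disjoint)
  also have "(u$1 - l$1) * (u$2 - l$2) = (\<Prod>b\<in>Basis. (u - l) \<bullet> b)"
  proof -
    have B: "(Basis :: (real^2) set) = {axis 1 1, axis 2 1}"
      by (auto simp: Basis_vec_def UNIV_2)
    have "axis 1 1 \<noteq> (axis 2 1 :: real^2)" by (simp add: axis_eq_axis)
    then show ?thesis unfolding B by (simp add: inner_axis)
  qed
  finally show "emeasure (distr (lborel :: (real \<times> real) measure) borel (\<lambda>p. vector [fst p, snd p])) (box l u)
      = ennreal (\<Prod>b\<in>Basis. (u - l) \<bullet> b)" .
qed simp

lemma emeasure_lborel_slices:
  fixes S :: "(real^2) set"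
  assumes "S \<in> sets borel"
  shows "emeasure lborel S = (\<integral>\<^sup>+y. emeasure lborel {x. vector [x, y] \<in> S} \<partial>lborel)"
proof -
  note m = borel_measurable_vector_2
  have s: "(\<lambda>p. vector [fst p, snd p]) -` S \<in> sets (lborel \<Otimes>\<^sub>M lborel :: (real\<times>real) measure)"
    unfolding lborel_prod using measurable_sets[OF m assms] by simp
  have "emeasure lborel S = emeasure (lborel \<Otimes>\<^sub>M lborel) ((\<lambda>p. vector [fst p, snd p]) -` S)"
    using m assms by (subst distr_vector_2_lborel[symmetric], subst emeasure_distr) (auto simp: lborel_prod)
  also have "\<dots> = (\<integral>\<^sup>+y. emeasure lborel ((\<lambda>x. (x, y)) -` ((\<lambda>p. vector [fst p, snd p]) -` S)) \<partial>lborel)"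
    by (rule lborel_pair.emeasure_pair_measure_alt2[OF s])
  also have "\<dots> = (\<integral>\<^sup>+y. emeasure lborel {x. vector [x, y] \<in> S} \<partial>lborel)"
    by (simp add: vimage_def)
  finally show ?thesis .
qed

section \<open>Ends of the horizontal slices of a compact convex set\<close>

definition right_end :: "(real^2) set \<Rightarrow> real \<Rightarrow> real" where
  "right_end K y = Sup {x. vector [x, y] \<in> K}"

definition left_end :: "(real^2) set \<Rightarrow> real \<Rightarrow> real" where
  "left_end K y = Inf {x. vector [x, y] \<in> K}"

lemma vector_2_eta [simp]: "vector [p $ 1, p $ 2] = (p :: real^2)"
  by (simp add: vec_eq_iff forall_2)

lemma compact_slice:
  assumes "compact (K :: (real^2) set)"
  shows "compact {x. vector [x, y] \<in> K}"
proof -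
  have *: "{x. vector [x, y] \<in> K} = (\<lambda>p. p $ 1) ` (K \<inter> {p. p $ 2 = y})"
  proof (intro equalityI subsetI)
    fix x assume "x \<in> {x. vector [x, y] \<in> K}"
    then show "x \<in> (\<lambda>p. p $ 1) ` (K \<inter> {p. p $ 2 = y})"
      by (intro image_eqI[of _ _ "vector [x, y]"]) auto
  qed auto
  have "closed {p :: real^2. p $ 2 = y}"
    by (intro closed_Collect_eq continuous_intros)
  then have "compact (K \<inter> {p. p $ 2 = y})" by (rule compact_Int_closed[OF assms])
  then show ?thesis
    unfolding * by (intro compact_continuous_image continuous_intros)
qed

context
  fixes K :: "(real^2) set"
  assumes K: "compact K" "convex K"
begin

text \<open>Compactness of the slice makes its \<open>Sup\<close> and \<open>Inf\<close> attained.
  The point \<open>p\<close> witnesses that the slice is nonempty; the ends carry no information at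
  heights that \<open>K\<close> misses.\<close>

lemma end_in:
  assumes "p \<in> K"
  shows "vector [right_end K (p$2), p$2] \<in> K" "vector [left_end K (p$2), p$2] \<in> K"
    "p$1 \<le> right_end K (p$2)" "left_end K (p$2) \<le> p$1"
proof -
  let ?S = "{x. vector [x, p$2] \<in> K}"
  have S: "compact ?S" "p$1 \<in> ?S" using compact_slice[OF K(1)] assms by auto
  have bd: "bounded ?S" by (rule compact_imp_bounded[OF S(1)])
  have b: "bdd_above ?S" "bdd_below ?S" "closed ?S" "?S \<noteq> {}"
    using S(2) bounded_imp_bdd_above[OF bd] bounded_imp_bdd_below[OF bd] compact_imp_closed[OF S(1)]
    by blast+
  show "vector [right_end K (p$2), p$2] \<in> K"
    using closed_contains_Sup[OF b(4,1,3)] by (simp add: right_end_def)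
  show "vector [left_end K (p$2), p$2] \<in> K"
    using closed_contains_Inf[OF b(4,2,3)] by (simp add: left_end_def)
  show "p$1 \<le> right_end K (p$2)" "left_end K (p$2) \<le> p$1"
    unfolding right_end_def left_end_def by (rule cSup_upper[OF S(2) b(1)], rule cInf_lower[OF S(2) b(2)])
qed

lemma slice_eq:
  assumes "p \<in> K"
  shows "{x. vector [x, p$2] \<in> K} = {left_end K (p$2) .. right_end K (p$2)}"
proof (intro equalityI subsetI)
  fix x assume "x \<in> {x. vector [x, p$2] \<in> K}"
  then show "x \<in> {left_end K (p$2) .. right_end K (p$2)}"
    using end_in[of "vector [x, p$2]"] by auto
next
  fix x assume x: "x \<in> {left_end K (p$2) .. right_end K (p$2)}"
  then have "x \<in> closed_segment (left_end K (p$2)) (right_end K (p$2))"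
    by (auto simp: closed_segment_eq_real_ivl)
  then obtain u where u: "0 \<le> u" "u \<le> 1" "x = (1-u) * left_end K (p$2) + u * right_end K (p$2)"
    by (auto simp: in_segment)
  have "(1-u) *\<^sub>R vector [left_end K (p$2), p$2] + u *\<^sub>R vector [right_end K (p$2), p$2] \<in> K"
    using u end_in(1,2)[OF assms] by (intro convexD_alt[OF K(2)]) auto
  also have "(1-u) *\<^sub>R vector [left_end K (p$2), p$2] + u *\<^sub>R vector [right_end K (p$2), p$2] = (vector [x, p$2] :: real^2)"
    using u by (simp add: vec_eq_iff forall_2 algebra_simps)
  finally show "x \<in> {x. vector [x, p$2] \<in> K}" by simp
qed

lemma between_in:
  assumes "p \<in> K" "q \<in> K" "p$2 < q$2" "p$2 \<le> y" "y \<le> q$2"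
  shows "vector [p$1 + (q$1 - p$1) * ((y - p$2) / (q$2 - p$2)), y] \<in> K"
proof -
  let ?u = "(y - p$2) / (q$2 - p$2)"
  have "(1 - ?u) *\<^sub>R p + ?u *\<^sub>R q \<in> K"
    using assms by (intro convexD_alt[OF K(2)]) (auto simp: field_simps)
  also have "(1 - ?u) *\<^sub>R p + ?u *\<^sub>R q = vector [p$1 + (q$1 - p$1) * ?u, y]"
  proof -
    have *: "?u * (q$2 - p$2) = y - p$2" using assms by simp
    have "(1 - ?u) * p$2 + ?u * q$2 = p$2 + ?u * (q$2 - p$2)" by algebra
    then have "(1 - ?u) * p$2 + ?u * q$2 = y" using * by simp
    moreover have "(1 - ?u) * p$1 + ?u * q$1 = p$1 + (q$1 - p$1) * ?u" by algebra
    ultimately show ?thesis by (simp add: vec_eq_iff forall_2)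
  qed
  finally show ?thesis .
qed

lemma level_in:
  assumes "p \<in> K" "q \<in> K" "p$2 \<le> y" "y \<le> q$2"
  obtains r where "r \<in> K" "r$2 = y"
proof (cases "p$2 < q$2")
  case True
  then show ?thesis using between_in[OF assms(1,2) True assms(3,4)] that by force
next
  case False
  then show ?thesis using assms that[of p] by auto
qed

text \<open>Superlevel sets of \<open>right_end K\<close> and sublevel sets of
  \<open>left_end K\<close> are projections of compact parts of \<open>K\<close>, hence closed
  within the interval. So both functions are measurable, and they are bounded because
  \<open>K\<close> is.\<close>

lemma ends_integrable:
  assumes "p \<in> K" "q \<in> K"
  shows "right_end K integrable_on {p$2..q$2}" "left_end K integrable_on {p$2..q$2}"
proof -
  let ?I = "{p$2..q$2}"
  have lev: "\<exists>r\<in>K. r$2 = y" if "y \<in> ?I" for y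
    using that by (metis atLeastAtMost_iff level_in[OF assms])
  obtain B where B: "\<And>r. r \<in> K \<Longrightarrow> norm r \<le> B"
    using K(1) compact_imp_bounded bounded_iff by metis
  have Bx: "\<bar>r$1\<bar> \<le> B" if "r \<in> K" for r
    using B[OF that] component_le_norm_cart[of r 1] by linarith
  have bR: "norm (right_end K y) \<le> B" "norm (left_end K y) \<le> B" if y: "y \<in> ?I" for y
  proof -
    obtain r where "r \<in> K" "r$2 = y" using lev[OF y] by auto
    then show "norm (right_end K y) \<le> B" "norm (left_end K y) \<le> B"
      using Bx[OF end_in(1)[of r]] Bx[OF end_in(2)[of r]] by auto
  qed
  have proj: "closed ((\<lambda>r. r$2) ` (K \<inter> {r. P (r$1)}))" if "closed {r::real^2. P (r$1)}" for P :: "real \<Rightarrow> bool"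
    using compact_Int_closed[OF K(1) that] by (intro compact_imp_closed compact_continuous_image continuous_intros)
  have cl: "closed {r::real^2. c \<le> r$1}" "closed {r::real^2. r$1 \<le> c}" for c
    by (intro closed_Collect_le continuous_intros)+
  have "{y \<in> ?I. c \<le> right_end K y} = ?I \<inter> (\<lambda>r. r$2) ` (K \<inter> {r. c \<le> r$1})" for c
  proof (intro equalityI subsetI)
    fix y assume y: "y \<in> {y \<in> ?I. c \<le> right_end K y}"
    then obtain r where "r \<in> K" "r$2 = y" using lev by blast
    then have "vector [right_end K y, y] \<in> K" using end_in(1) by blast
    then have "y \<in> (\<lambda>r. r$2) ` (K \<inter> {r. c \<le> r$1})"
      using y by (intro image_eqI[of _ _ "vector [right_end K y, y]"]) simp_all
    with y show "y \<in> ?I \<inter> (\<lambda>r. r$2) ` (K \<inter> {r. c \<le> r$1})" by blast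
  next
    fix y assume "y \<in> ?I \<inter> (\<lambda>r. r$2) ` (K \<inter> {r. c \<le> r$1})"
    then obtain r where "y \<in> ?I" "r \<in> K" "c \<le> r$1" "y = r$2" by blast
    then show "y \<in> {y \<in> ?I. c \<le> right_end K y}" using end_in(3)[of r] by simp
  qed
  then have "{y \<in> ?I. c \<le> right_end K y} \<in> sets (lebesgue_on ?I)" for c
    using proj[OF cl(1)] by (simp only:) (intro sets_restrict_space_iff[THEN iffD2]; simp)
  then have m1: "right_end K \<in> borel_measurable (lebesgue_on ?I)"
    unfolding borel_measurable_iff_ge by (simp only: space_restrict_space) simp
  have "{y \<in> ?I. left_end K y \<le> c} = ?I \<inter> (\<lambda>r. r$2) ` (K \<inter> {r. r$1 \<le> c})" for c
  proof (intro equalityI subsetI)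
    fix y assume y: "y \<in> {y \<in> ?I. left_end K y \<le> c}"
    then obtain r where "r \<in> K" "r$2 = y" using lev by blast
    then have "vector [left_end K y, y] \<in> K" using end_in(2) by blast
    then have "y \<in> (\<lambda>r. r$2) ` (K \<inter> {r. r$1 \<le> c})"
      using y by (intro image_eqI[of _ _ "vector [left_end K y, y]"]) simp_all
    with y show "y \<in> ?I \<inter> (\<lambda>r. r$2) ` (K \<inter> {r. r$1 \<le> c})" by blast
  next
    fix y assume "y \<in> ?I \<inter> (\<lambda>r. r$2) ` (K \<inter> {r. r$1 \<le> c})"
    then obtain r where "y \<in> ?I" "r \<in> K" "r$1 \<le> c" "y = r$2" by blast
    then show "y \<in> {y \<in> ?I. left_end K y \<le> c}" using end_in(4)[of r] by simp
  qed
  then have "{y \<in> ?I. left_end K y \<le> c} \<in> sets (lebesgue_on ?I)" for c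
    using proj[OF cl(2)] by (simp only:) (intro sets_restrict_space_iff[THEN iffD2]; simp)
  then have m2: "left_end K \<in> borel_measurable (lebesgue_on ?I)"
    unfolding borel_measurable_iff_le by (simp only: space_restrict_space) simp
  show "right_end K integrable_on ?I" "left_end K integrable_on ?I"
    using measurable_bounded_by_integrable_imp_integrable[OF m1 integrable_const_ivl[of B] bR(1)]
      measurable_bounded_by_integrable_imp_integrable[OF m2 integrable_const_ivl[of B] bR(2)]
    by simp_all
qed

lemma has_integral_chord:
  fixes a b c d :: real
  assumes "a \<le> b"
  shows "((\<lambda>y. c + (d - c) * ((y - a) / (b - a))) has_integral (c + d) * (b - a) / 2) {a..b}"
\<comment> \<open>If \<open>a = b\<close>, division by zero turns the integrand into the constant
  \<open>c\<close>, but the interval is a single point and both sides vanish.\<close>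
proof (cases "a = b")
  case False
  with assms have ab: "a < b" by simp
  define m where "m = (d - c) / (b - a)"
  let ?P = "\<lambda>y. c * y + m * (y - a)\<^sup>2 / 2"
  have "((\<lambda>y. c + m * (y - a)) has_integral (?P b - ?P a)) {a..b}"
    using assms by (intro fundamental_theorem_of_calculus)
      (auto intro!: derivative_eq_intros simp flip: has_real_derivative_iff_has_vector_derivative)
  also have "(\<lambda>y. c + m * (y - a)) = (\<lambda>y. c + (d - c) * ((y - a) / (b - a)))"
    by (simp add: m_def)
  also have "?P b - ?P a = c * (b - a) + (m * (b - a)) * (b - a) / 2"
    by (simp add: algebra_simps power2_eq_square)
  also have "m * (b - a) = d - c" using ab by (simp add: m_def)
  also have "c * (b - a) + (d - c) * (b - a) / 2 = (c + d) * (b - a) / 2" by (simp add: field_simps)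
  finally show ?thesis .
qed (auto simp: has_integral_refl)

text \<open>By convexity the chord from \<open>p\<close> to \<open>q\<close> lies in
  \<open>K\<close>, hence nowhere to the right of the right end; the left side is the integral of
  the chord.\<close>

lemma right_end_chord:
  assumes "p \<in> K" "q \<in> K" "p$2 \<le> q$2"
  shows "(p$1 + q$1) * (q$2 - p$2) / 2 \<le> integral {p$2..q$2} (right_end K)"
proof (cases "p$2 < q$2")
  case True
  have "p$1 + (q$1 - p$1) * ((y - p$2) / (q$2 - p$2)) \<le> right_end K y" if "y \<in> {p$2..q$2}" for y
    using end_in(3)[OF between_in[OF assms(1,2) True]] that by auto
  then show ?thesis
    by (rule has_integral_le[OF has_integral_chord[OF assms(3)] integrable_integral[OF ends_integrable(1)[OF assms(1,2)]]])
qed (use assms in auto)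

lemma left_end_chord:
  assumes "p \<in> K" "q \<in> K" "p$2 \<le> q$2"
  shows "integral {p$2..q$2} (left_end K) \<le> (p$1 + q$1) * (q$2 - p$2) / 2"
proof (cases "p$2 < q$2")
  case True
  have "left_end K y \<le> p$1 + (q$1 - p$1) * ((y - p$2) / (q$2 - p$2))" if "y \<in> {p$2..q$2}" for y
    using end_in(4)[OF between_in[OF assms(1,2) True]] that by auto
  then show ?thesis
    by (rule has_integral_le[OF integrable_integral[OF ends_integrable(2)[OF assms(1,2)]] has_integral_chord[OF assms(3)]])
qed (use assms in auto)

text \<open>By Fubini the left side is the area of the part of \<open>K\<close> between the heights
  of \<open>p\<close> and \<open>q\<close>; slices at other heights only add to the area.\<close>

lemma integral_ends_le_measure:
  assumes "p \<in> K" "q \<in> K"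
  shows "integral {p$2..q$2} (right_end K) - integral {p$2..q$2} (left_end K) \<le> measure lebesgue K"
proof -
  let ?I = "{p$2..q$2}" and ?w = "\<lambda>y. right_end K y - left_end K y"
  have sl: "{x. vector [x, y] \<in> K} = {left_end K y..right_end K y} \<and> left_end K y \<le> right_end K y" if y: "y \<in> ?I" for y
  proof -
    obtain r where "r \<in> K" "r$2 = y" using level_in[OF assms, of y] y by auto
    then show ?thesis using slice_eq[of r] end_in(3,4)[of r] by auto
  qed
  have I: "(?w has_integral integral ?I (right_end K) - integral ?I (left_end K)) ?I"
    using ends_integrable[OF assms] by (intro has_integral_diff integrable_integral)
  have bK: "K \<in> sets borel" using K(1) by (simp add: borel_closed compact_imp_closed)
  have "ennreal (integral ?I (right_end K) - integral ?I (left_end K)) = (\<integral>\<^sup>+y. ennreal (?w y) * indicator ?I y \<partial>lborel)"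
    using sl by (intro nn_integral_has_integral_lebesgue'[OF _ I, symmetric]) auto
  also have "\<dots> \<le> (\<integral>\<^sup>+y. emeasure lborel {x. vector [x, y] \<in> K} \<partial>lborel)"
    using sl by (intro nn_integral_mono) (auto simp: indicator_def)
  also have "\<dots> = emeasure lborel K"
    by (rule emeasure_lborel_slices[OF bK, symmetric])
  also have "\<dots> = ennreal (measure lebesgue K)"
    using K(1) bK emeasure_compact_finite[OF K(1)] by (simp add: emeasure_eq_ennreal_measure measure_completion)
  finally show ?thesis by (simp add: ennreal_le_iff)
qed

section \<open>Antiderivatives of the slice ends and signed polygon areas\<close>

lemma chain_potentials_aux:
  "\<exists>F G. (\<forall>p\<in>K. \<forall>q\<in>K. p$2 \<le> q$2 \<longrightarrow> (p$1 + q$1) * (q$2 - p$2) / 2 \<le> F (q$2) - F (p$2)) \<and>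
    (\<forall>p\<in>K. \<forall>q\<in>K. q$2 \<le> p$2 \<longrightarrow> (p$1 + q$1) * (q$2 - p$2) / 2 \<le> G (q$2) - G (p$2)) \<and>
    (\<forall>p\<in>K. \<forall>q\<in>K. p$2 \<le> q$2 \<longrightarrow> (F (q$2) - F (p$2)) - (G (q$2) - G (p$2)) \<le> measure lebesgue K)"
proof (cases "K = {}")
  case False
  \<comment> \<open>Integrals start at the lowest height of \<open>K\<close>, so every interval used
    lies between heights of two points of \<open>K\<close>, where \<open>ends_integrable\<close>
    applies.\<close>
  then obtain m where m: "m \<in> K" "\<And>r. r \<in> K \<Longrightarrow> m$2 \<le> r$2"
    using continuous_attains_inf[OF K(1) False, of "\<lambda>r. r$2"] by (force intro: continuous_intros)
  have comb: "integral {m$2..q$2} f - integral {m$2..p$2} f = integral {p$2..q$2} f"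
    if "p \<in> K" "q \<in> K" "p$2 \<le> q$2" "f integrable_on {m$2..q$2}" for p q and f :: "real \<Rightarrow> real"
    using Henstock_Kurzweil_Integration.integral_combine[OF m(2)[OF that(1)] that(3,4)] by (simp add: algebra_simps)
  note combR = comb[OF _ _ _ ends_integrable(1)[OF m(1)]] and combL = comb[OF _ _ _ ends_integrable(2)[OF m(1)]]
  show ?thesis
  proof (rule exI[of _ "\<lambda>y. integral {m$2..y} (right_end K)"], rule exI[of _ "\<lambda>y. integral {m$2..y} (left_end K)"],
      intro conjI ballI impI)
    fix p q assume pq: "p \<in> K" "q \<in> K" "p$2 \<le> q$2"
    show "(p$1 + q$1) * (q$2 - p$2) / 2 \<le> integral {m$2..q$2} (right_end K) - integral {m$2..p$2} (right_end K)"
      using right_end_chord[OF pq] combR[OF pq pq(2)] by simp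
  next
    fix p q assume pq: "p \<in> K" "q \<in> K" "p$2 \<le> q$2"
    show "integral {m$2..q$2} (right_end K) - integral {m$2..p$2} (right_end K) -
       (integral {m$2..q$2} (left_end K) - integral {m$2..p$2} (left_end K)) \<le> measure lebesgue K"
      using integral_ends_le_measure[OF pq(1,2)] combR[OF pq pq(2)] combL[OF pq pq(2)] by simp
  next
    fix p q assume pq: "p \<in> K" "q \<in> K" "q$2 \<le> p$2"
    have "(p$1 + q$1) * (q$2 - p$2) / 2 = - ((q$1 + p$1) * (p$2 - q$2) / 2)"
      by (simp add: field_simps)
    then show "(p$1 + q$1) * (q$2 - p$2) / 2 \<le> integral {m$2..q$2} (left_end K) - integral {m$2..p$2} (left_end K)"
      using left_end_chord[OF pq(2,1,3)] combL[OF pq(2,1,3) pq(1)] by simp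
  qed
qed auto

end

text \<open>Summed over the edges of a closed polygon, this gives twice its signed area.\<close>

definition trap :: "real \<Rightarrow> real \<Rightarrow> real \<Rightarrow> real \<Rightarrow> real" where
  "trap x y x' y' = (x + x') * (y' - y)"

text \<open>\<open>F\<close> and \<open>G\<close> are antiderivatives of the right and left ends of the slices of \<open>K\<close>. For a closed
  polygon with vertices in \<open>K\<close> consisting of an ascending and a descending chain,
  the inequalities telescope to a bound of its signed area by the area of \<open>K\<close>.\<close>

definition chain_potentials :: "(real^2) set \<Rightarrow> (real \<Rightarrow> real) \<Rightarrow> (real \<Rightarrow> real) \<Rightarrow> bool" where
  "chain_potentials K F G \<longleftrightarrow>
    (\<forall>x y x' y'. vector [x, y] \<in> K \<longrightarrow> vector [x', y'] \<in> K \<longrightarrow>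
      (y \<le> y' \<longrightarrow> trap x y x' y' \<le> 2 * F y' - 2 * F y) \<and>
      (y' \<le> y \<longrightarrow> trap x y x' y' \<le> 2 * G y' - 2 * G y) \<and>
      (y \<le> y' \<longrightarrow> (F y' - F y) - (G y' - G y) \<le> measure lebesgue K))"

lemma chain_potentials_exist:
  assumes "compact K" "convex (K :: (real^2) set)"
  shows "\<exists>F G. chain_potentials K F G"
proof -
  obtain F G where
    F: "\<forall>p\<in>K. \<forall>q\<in>K. p$2 \<le> q$2 \<longrightarrow> (p$1 + q$1) * (q$2 - p$2) / 2 \<le> F (q$2) - F (p$2)" and
    G: "\<forall>p\<in>K. \<forall>q\<in>K. q$2 \<le> p$2 \<longrightarrow> (p$1 + q$1) * (q$2 - p$2) / 2 \<le> G (q$2) - G (p$2)" and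
    A: "\<forall>p\<in>K. \<forall>q\<in>K. p$2 \<le> q$2 \<longrightarrow> (F (q$2) - F (p$2)) - (G (q$2) - G (p$2)) \<le> measure lebesgue K"
    using chain_potentials_aux[OF assms] by blast
  have "chain_potentials K F G"
    unfolding chain_potentials_def trap_def
  proof (intro allI impI conjI)
    fix x y x' y' :: real assume pq: "vector [x, y] \<in> K" "vector [x', y'] \<in> K"
    show "(x + x') * (y' - y) \<le> 2 * F y' - 2 * F y" if "y \<le> y'"
      using F[rule_format, OF pq] that by simp
    show "(x + x') * (y' - y) \<le> 2 * G y' - 2 * G y" if "y' \<le> y"
      using G[rule_format, OF pq] that by simp
    show "(F y' - F y) - (G y' - G y) \<le> measure lebesgue K" if "y \<le> y'"
      using A[rule_format, OF pq] that by simp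
  qed
  then show ?thesis by blast
qed

lemma
  assumes "chain_potentials K F G" "vector [x, y] \<in> K" "vector [x', y'] \<in> K"
  shows trap_right: "y \<le> y' \<Longrightarrow> trap x y x' y' \<le> 2 * F y' - 2 * F y"
    and trap_left: "y' \<le> y \<Longrightarrow> trap x y x' y' \<le> 2 * G y' - 2 * G y"
    and chain_measure: "y \<le> y' \<Longrightarrow> (F y' - F y) - (G y' - G y) \<le> measure lebesgue K"
  using assms unfolding chain_potentials_def by blast+

section \<open>Bounds from particular polygons\<close>

text \<open>A quadrilateral with a horizontal diagonal of length 1 and its other vertices at heights
  \<open>b\<close> and \<open>t\<close> has signed area \<open>(t - b) / 2\<close>, whatever
  \<open>u\<close> and \<open>v\<close> are.\<close>

lemma width_le_measure:
  assumes K: "compact K" "convex (K :: (real^2) set)"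
    and l: "vector [x, c] \<in> K" and r: "vector [x + 1, c] \<in> K"
    and b: "vector [u, b] \<in> K" and t: "vector [v, t] \<in> K" and "b \<le> c" "c \<le> t"
  shows "t - b \<le> 2 * measure lebesgue K"
proof -
  obtain F G where FG: "chain_potentials K F G" using chain_potentials_exist[OF K] by blast
  note F = trap_right[OF FG] and G = trap_left[OF FG] and A = chain_measure[OF FG]
  have "trap u b (x+1) c + trap (x+1) c v t + trap v t x c + trap x c u b \<le> 2 * measure lebesgue K"
    using F[OF b r] F[OF r t] G[OF t l] G[OF l b] A[OF b t] assms by linarith
  then show ?thesis by (simp add: trap_def algebra_simps)
qed

text \<open>A determinant bound that permits skipping the lowest triangle vertex in
  \<open>heights_le_measure\<close>. There \<open>a\<close> and \<open>b\<close> are the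
  (\<open>l1\<close>, \<open>l2\<close>) coordinates, relative to that vertex, of the support points
  of \<open>l1\<close> and \<open>l2\<close>. The last two hypotheses say that neither point is
  higher than the vertex.\<close>

lemma star_cross_nonneg:
  fixes a1 a2 b1 b2 :: real
  assumes "0 \<le> a1" "0 \<le> b2" "b1 \<le> a1" "a2 \<le> b2" "0 \<le> a1 + a2" "0 \<le> b1 + b2"
  shows "a2 * b1 \<le> a1 * b2"
proof (cases "0 \<le> a2")
  case True
  show ?thesis
  proof (cases "0 \<le> b1")
    case True
    then show ?thesis using assms \<open>0 \<le> a2\<close> by (subst mult.commute) (intro mult_mono; simp)
  next
    case False
    then have "a2 * b1 \<le> 0" using \<open>0 \<le> a2\<close> by (simp add: mult_nonneg_nonpos)
    then show ?thesis using assms by (smt (verit) mult_nonneg_nonneg)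
  qed
next
  case False
  show ?thesis
  proof (cases "0 \<le> b1")
    case True
    then have "a2 * b1 \<le> 0" using False by (simp add: mult_nonpos_nonneg)
    then show ?thesis using assms by (smt (verit) mult_nonneg_nonneg)
  next
    case False
    have "(- a2) * (- b1) \<le> a1 * b2" using assms False \<open>\<not> 0 \<le> a2\<close> by (intro mult_mono) auto
    then show ?thesis by simp
  qed
qed

text \<open>The hexagon alternates between the triangle vertices and support points
  \<open>P1\<close>, \<open>P2\<close>, \<open>P3\<close> of \<open>l1\<close>, \<open>l2\<close>,
  \<open>l3\<close>. Moving a support point affects twice the signed area only through the matching
  maximum, with factor 2/3. As the values of the \<open>lk\<close> on the corresponding triangle
  sides sum to 2/3, twice the area is exactly 2/3 times the sum of the maxima.\<close>

lemma heights_le_measure: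
  fixes K :: "(real^2) set"
  assumes K: "compact K" "convex K"
    and Q: "vector [x, y] \<in> K" "vector [x - 2/3, y] \<in> K" "vector [x, y - 2/3] \<in> K"
    and P1: "vector [x1, y1] \<in> K" and P2: "vector [x2, y2] \<in> K" and P3: "vector [x3, y3] \<in> K"
    and M1: "\<And>u v. vector [u, v] \<in> K \<Longrightarrow> - u - v \<le> - x1 - y1"
    and M2: "\<And>u v. vector [u, v] \<in> K \<Longrightarrow> u \<le> x2"
    and M3: "\<And>u v. vector [u, v] \<in> K \<Longrightarrow> v \<le> y3"
  shows "- x1 - y1 + x2 + y3 \<le> 3 * measure lebesgue K"
proof -
  obtain F G where FG: "chain_potentials K F G" using chain_potentials_exist[OF K] by blast
  note F = trap_right[OF FG] and G = trap_left[OF FG] and A = chain_measure[OF FG]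
  let ?m = "2 * measure lebesgue K"
  note pts = Q P1 P2 P3
  have top: "y \<le> y3" "y1 \<le> y3" "y2 \<le> y3" using M3 pts by blast+
  have m1: "- x - (y - 2/3) \<le> - x1 - y1" "- x3 - y3 \<le> - x1 - y1" "- x2 - y2 \<le> - x1 - y1" "- (x-2/3) - y \<le> - x1 - y1"
    using M1 pts by blast+
  have m2: "x \<le> x2" "x1 \<le> x2" "x3 \<le> x2" using M2 pts by blast+
  have full: "trap x y x3 y3 + trap x3 y3 (x-2/3) y + trap (x-2/3) y x1 y1 + trap x1 y1 x (y-2/3) + trap x (y-2/3) x2 y2 + trap x2 y2 x y
    = 2/3 * (- x1 - y1 + x2 + y3)"
    unfolding trap_def by (simp add: field_simps)
  txt \<open>A triangle vertex that would destroy unimodality can be skipped: since the neighbouring vertices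
    are support points of \<open>K\<close>, skipping it only increases the signed area.\<close>
  have drop2: "trap x3 y3 (x-2/3) y + trap (x-2/3) y x1 y1 \<le> trap x3 y3 x1 y1" if "y \<le> y1"
  proof -
    have "(- x3 - y3 + (x-2/3) + y) * (y1 - y) \<le> (- x1 - y1 + (x-2/3) + y) * (y1 - y)"
      using m1 that by (intro mult_right_mono) auto
    also have "\<dots> \<le> (- x1 - y1 + (x-2/3) + y) * (y3 - y)"
      using m1 top by (intro mult_left_mono) auto
    finally show ?thesis unfolding trap_def by (simp add: field_simps)
  qed
  have drop1: "trap x2 y2 x y + trap x y x3 y3 \<le> trap x2 y2 x3 y3" if "y \<le> y2"
  proof -
    have "(x3 - x) * (y2 - y) \<le> (x2 - x) * (y3 - y)"
      using m2 top that by (smt (verit) mult_left_mono mult_right_mono)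
    then show ?thesis unfolding trap_def by (simp add: field_simps)
  qed
  have drop3: "trap x1 y1 x (y-2/3) + trap x (y-2/3) x2 y2 \<le> trap x1 y1 x2 y2" if "y1 \<le> y - 2/3" "y2 \<le> y - 2/3"
  proof -
    have "(x1 - x) * ((- x2 - y2) - (- x - (y-2/3))) \<le> ((- x1 - y1) - (- x - (y-2/3))) * (x2 - x)"
      using m1 m2 that by (intro star_cross_nonneg) auto
    then show ?thesis unfolding trap_def by (simp add: field_simps)
  qed
  have dn: "trap x3 y3 (x-2/3) y + trap (x-2/3) y x1 y1 \<le> 2 * G y1 - 2 * G y3"
  proof (cases "y \<le> y1")
    case True
    then show ?thesis using drop2 G[OF P3 P1] top by linarith
  next
    case False
    then show ?thesis using G[OF P3 Q(2)] G[OF Q(2) P1] top by linarith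
  qed
  have up: "trap x2 y2 x y + trap x y x3 y3 \<le> 2 * F y3 - 2 * F y2"
  proof (cases "y \<le> y2")
    case True
    then show ?thesis using drop1 F[OF P2 P3] top by linarith
  next
    case False
    then show ?thesis using F[OF P2 Q(1)] F[OF Q(1) P3] top by linarith
  qed
  have "trap x y x3 y3 + trap x3 y3 (x-2/3) y + trap (x-2/3) y x1 y1 + trap x1 y1 x (y-2/3) + trap x (y-2/3) x2 y2 + trap x2 y2 x y \<le> ?m"
  proof -
    \<comment> \<open>The cases decide where the ascending chain begins: at \<open>P1\<close>, at
      \<open>P2\<close>, or at the lower triangle vertex. In the first two cases that vertex is no
      lower than both neighbours and is skipped by \<open>drop3\<close>.\<close>
    consider "y1 \<le> y - 2/3" "y2 \<le> y - 2/3" "y1 \<le> y2" | "y1 \<le> y - 2/3" "y2 \<le> y - 2/3" "y2 \<le> y1"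
      | "y1 \<le> y - 2/3" "y - 2/3 \<le> y2" | "y - 2/3 \<le> y1" "y2 \<le> y - 2/3" | "y - 2/3 \<le> y1" "y - 2/3 \<le> y2"
      by linarith
    then show ?thesis
    proof cases
      case 1
      then show ?thesis using up dn drop3 F[OF P1 P2] A[OF P1 P3] top by linarith
    next
      case 2
      then show ?thesis using up dn drop3 G[OF P1 P2] A[OF P2 P3] top by linarith
    next
      case 3
      then show ?thesis using up dn F[OF P1 Q(3)] F[OF Q(3) P2] A[OF P1 P3] top by linarith
    next
      case 4
      then show ?thesis using up dn G[OF P1 Q(3)] G[OF Q(3) P2] A[OF P2 P3] top by linarith
    next
      case 5
      then show ?thesis using up dn G[OF P1 Q(3)] F[OF Q(3) P2] A[OF Q(3) P3] top by linarith
    qed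
  qed
  then show ?thesis unfolding full by simp
qed

text \<open>A point of the plane is given by its coordinates (\<open>l2\<close>, \<open>l3\<close>), with \<open>l1 = - l2 - l3\<close>. The first six points
  are the endpoints of unit segments in directions (1,-1), (0,1) and (1,0), listed counterclockwise; if \<open>sk\<close>
  denotes the midpoint of the k-th segment, then, with indices mod 3, \<open>lk\<close> takes the values \<open>c + dk\<close> at
  \<open>s(k+1)\<close> and \<open>c - dk\<close> at \<open>s(k+2)\<close>. That the means of these pairs agree is a normalization by
  a translation. The last three points are the vertices of a triangle with centroid (\<open>t2\<close>, \<open>t3\<close>).\<close>

definition hex_config :: "(real^2) set \<Rightarrow> real \<Rightarrow> real \<Rightarrow> real \<Rightarrow> real \<Rightarrow> real \<Rightarrow> real \<Rightarrow> real \<Rightarrow> bool" where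
  "hex_config K c d1 d2 d3 t1 t2 t3 \<longleftrightarrow> compact K \<and> convex K \<and> t1 + t2 + t3 = 0 \<and>
    vector [c - d2 + 1/2, c + d3 - 1/2] \<in> K \<and>
    vector [c + d2 + 1/2, - 2 * c + d1 - d2] \<in> K \<and>
    vector [- 2 * c + d3 - d1, c - d3 + 1/2] \<in> K \<and>
    vector [c - d2 - 1/2, c + d3 + 1/2] \<in> K \<and>
    vector [c + d2 - 1/2, - 2 * c + d1 - d2] \<in> K \<and>
    vector [- 2 * c + d3 - d1, c - d3 - 1/2] \<in> K \<and>
    vector [t2 + 2/9, t3 + 2/9] \<in> K \<and>
    vector [t2 - 4/9, t3 + 2/9] \<in> K \<and>
    vector [t2 + 2/9, t3 - 4/9] \<in> K"

lemma hex_configD: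
  assumes "hex_config K c d1 d2 d3 t1 t2 t3"
  shows "compact K" "convex K" "t1 + t2 + t3 = 0"
    "vector [c - d2 + 1/2, c + d3 - 1/2] \<in> K"
    "vector [c + d2 + 1/2, - 2 * c + d1 - d2] \<in> K"
    "vector [- 2 * c + d3 - d1, c - d3 + 1/2] \<in> K"
    "vector [c - d2 - 1/2, c + d3 + 1/2] \<in> K"
    "vector [c + d2 - 1/2, - 2 * c + d1 - d2] \<in> K"
    "vector [- 2 * c + d3 - d1, c - d3 - 1/2] \<in> K"
    "vector [t2 + 2/9, t3 + 2/9] \<in> K"
    "vector [t2 - 4/9, t3 + 2/9] \<in> K"
    "vector [t2 + 2/9, t3 - 4/9] \<in> K"
  using assms unfolding hex_config_def by blast+

text \<open>Twice the signed area of the triangle formed by the midpoints of the three segments.\<close>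

definition disc :: "real \<Rightarrow> real \<Rightarrow> real \<Rightarrow> real \<Rightarrow> real" where
  "disc c d1 d2 d3 = 9 * c\<^sup>2 + 2 * (d1 * d2 + d2 * d3 + d3 * d1) - (d1\<^sup>2 + d2\<^sup>2 + d3\<^sup>2)"

text \<open>With a common midpoint the three segments span a hexagon of area 3/4; in general its
  signed area is smaller by \<open>disc\<close>. The bounds on \<open>c\<close> and \<open>s\<close>
  make \<open>l3\<close> unimodal along it, the sign of \<open>d3\<close> deciding which endpoints
  are highest and lowest.\<close>

lemma hexagon_le_measure:
  assumes H: "hex_config K c d1 d2 d3 t1 t2 t3" and c: "0 \<le> c"
    and s: "3 * c + \<bar>d1\<bar> + \<bar>d2\<bar> + \<bar>d3\<bar> \<le> 1/2"
  shows "3/4 - disc c d1 d2 d3 \<le> measure lebesgue K"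
proof -
  note V = hex_configD(4-9)[OF H]
  obtain F G where FG: "chain_potentials K F G" using chain_potentials_exist[OF hex_configD(1,2)[OF H]] by blast
  note F = trap_right[OF FG] and G = trap_left[OF FG] and A = chain_measure[OF FG]
  have "trap (c-d2+1/2) (c+d3-1/2) (c+d2+1/2) (-2*c+d1-d2) +
      trap (c+d2+1/2) (-2*c+d1-d2) (-2*c+d3-d1) (c-d3+1/2) +
      trap (-2*c+d3-d1) (c-d3+1/2) (c-d2-1/2) (c+d3+1/2) +
      trap (c-d2-1/2) (c+d3+1/2) (c+d2-1/2) (-2*c+d1-d2) +
      trap (c+d2-1/2) (-2*c+d1-d2) (-2*c+d3-d1) (c-d3-1/2) +
      trap (-2*c+d3-d1) (c-d3-1/2) (c-d2+1/2) (c+d3-1/2) \<le> 2 * measure lebesgue K"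
  proof (cases "0 \<le> d3")
    case True
    then show ?thesis
      using F[OF V(1,2)] F[OF V(2,3)] F[OF V(3,4)] G[OF V(4,5)] G[OF V(5,6)] F[OF V(6,1)] A[OF V(6,4)] s c by argo
  next
    case False
    then show ?thesis
      using F[OF V(1,2)] F[OF V(2,3)] G[OF V(3,4)] G[OF V(4,5)] G[OF V(5,6)] G[OF V(6,1)] A[OF V(1,3)] s c by argo
  qed
  then show ?thesis unfolding trap_def disc_def by (simp add: field_simps power2_eq_square)
qed

text \<open>The triangle vertices are inserted into three alternate edges of the hexagon. These
  edges have vector sum zero, so the signed area does not depend on the position of the triangle.
  The conditions \<open>t\<close> give unimodality of \<open>l3\<close>: the lowest triangle vertex
  is no higher than the higher of the two lower endpoints of segments 1 and 2, and the other two
  vertices lie between the third segment and the upper endpoints of segments 1 and 2.\<close>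

lemma nonagon_le_measure:
  assumes H: "hex_config K c d1 d2 d3 t1 t2 t3" and c: "0 \<le> c"
    and s: "3 * c + \<bar>d1\<bar> + \<bar>d2\<bar> + \<bar>d3\<bar> \<le> 1/2"
    and t: "t3 - 4/9 \<le> c + \<bar>d3\<bar> - 1/2" "- 2 * c + d1 - d2 \<le> t3 + 2/9" "\<bar>d3\<bar> \<le> 1/6"
  shows "17/24 - disc c d1 d2 d3 / 2 + c / 2 \<le> measure lebesgue K"
proof -
  note V = hex_configD(4-9)[OF H] and Q = hex_configD(10-12)[OF H]
  obtain F G where FG: "chain_potentials K F G" using chain_potentials_exist[OF hex_configD(1,2)[OF H]] by blast
  note F = trap_right[OF FG] and G = trap_left[OF FG] and A = chain_measure[OF FG]
  have "trap (c-d2+1/2) (c+d3-1/2) (c+d2+1/2) (-2*c+d1-d2) +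
      trap (c+d2+1/2) (-2*c+d1-d2) (t2+2/9) (t3+2/9) +
      trap (t2+2/9) (t3+2/9) (-2*c+d3-d1) (c-d3+1/2) +
      trap (-2*c+d3-d1) (c-d3+1/2) (c-d2-1/2) (c+d3+1/2) +
      trap (c-d2-1/2) (c+d3+1/2) (t2-4/9) (t3+2/9) +
      trap (t2-4/9) (t3+2/9) (c+d2-1/2) (-2*c+d1-d2) +
      trap (c+d2-1/2) (-2*c+d1-d2) (-2*c+d3-d1) (c-d3-1/2) +
      trap (-2*c+d3-d1) (c-d3-1/2) (t2+2/9) (t3-4/9) +
      trap (t2+2/9) (t3-4/9) (c-d2+1/2) (c+d3-1/2) \<le> 2 * measure lebesgue K"
  proof (cases "0 \<le> d3")
    case True
    note f = F[OF V(1,2)] F[OF V(2) Q(1)] F[OF Q(1) V(3)] F[OF V(3,4)] G[OF V(4) Q(2)] G[OF Q(2) V(5)] G[OF V(5,6)]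
      F[OF Q(3) V(1)]
    show ?thesis
    \<comment> \<open>The lowest vertex of the nonagon is either a segment endpoint or the inserted
      triangle vertex.\<close>
    proof (cases "c - d3 - 1/2 \<le> t3 - 4/9")
      case a: True
      then show ?thesis using f F[OF V(6) Q(3)] A[OF V(6,4)] s c t True by argo
    next
      case False
      then show ?thesis using f G[OF V(6) Q(3)] A[OF Q(3) V(4)] s c t True by argo
    qed
  next
    case False
    note f = F[OF V(1,2)] F[OF V(2) Q(1)] F[OF Q(1) V(3)] G[OF V(3,4)] G[OF V(4) Q(2)] G[OF Q(2) V(5)] G[OF V(5,6)]
      G[OF V(6) Q(3)]
    show ?thesis
    proof (cases "c + d3 - 1/2 \<le> t3 - 4/9")
      case True
      then show ?thesis using f G[OF Q(3) V(1)] A[OF V(1,3)] s c t False by argo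
    next
      case a: False
      then show ?thesis using f F[OF Q(3) V(1)] A[OF Q(3) V(3)] s c t False by argo
    qed
  qed
  then show ?thesis unfolding trap_def disc_def by (simp add: field_simps power2_eq_square)
qed

section \<open>Estimates of \<open>disc\<close> and the area of a normalized configuration\<close>

lemma disc_le: "disc c d1 d2 d3 \<le> 9 * c\<^sup>2 + (\<bar>d1\<bar> + \<bar>d2\<bar> + \<bar>d3\<bar>)\<^sup>2 / 3"
proof -
  have ab: "2 * (d1 * d2 + d2 * d3 + d3 * d1) \<le> 2 * (\<bar>d1\<bar> * \<bar>d2\<bar> + \<bar>d2\<bar> * \<bar>d3\<bar> + \<bar>d3\<bar> * \<bar>d1\<bar>)"
    by (intro mult_left_mono add_mono) (simp_all flip: abs_mult)
  have "2 * (x * y + y * z + z * x) - (x\<^sup>2 + y\<^sup>2 + z\<^sup>2) \<le> (x + y + z)\<^sup>2 / 3" for x y z :: real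
  proof -
    have "0 \<le> (x - y)\<^sup>2 + (y - z)\<^sup>2 + (z - x)\<^sup>2" by simp
    then show ?thesis by (simp add: power2_eq_square field_simps)
  qed
  from this[of "\<bar>d1\<bar>" "\<bar>d2\<bar>" "\<bar>d3\<bar>"] ab show ?thesis unfolding disc_def power2_abs by linarith
qed

text \<open>Under these conditions the hexagon of the segment endpoints has area at least 2/3.\<close>

lemma disc_small:
  assumes c: "3 * c + \<bar>d1\<bar> + \<bar>d2\<bar> + \<bar>d3\<bar> \<le> 1/2" and g: "1/4 \<le> 3 * c"
    and d: "3 * c - 1/6 \<le> d1 - d2 - \<bar>d3\<bar>"
  shows "disc c d1 d2 d3 \<le> 1/12"
proof -
  define g where "g = 3 * c"
  define h where "h = d1 - d2 - \<bar>d3\<bar>"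
  have g3: "g \<le> 1/3" using c d unfolding g_def by linarith
  have g4: "1/4 \<le> g" using assms(2) by (simp add: g_def)
  have D: "disc c d1 d2 d3 = g\<^sup>2 - (d1 - d2)\<^sup>2 + 2 * d3 * (d1 + d2) - d3\<^sup>2"
    unfolding disc_def g_def by (simp add: power2_eq_square algebra_simps)
  have h: "g - 1/6 \<le> h" using d by (simp add: g_def h_def)
  have hh: "(g - 1/6)\<^sup>2 \<le> h\<^sup>2" using h g4 by (intro power_mono) auto
  have d3: "2 * d3 * (d1 + d2) \<le> 2 * \<bar>d3\<bar> * \<bar>d1 + d2\<bar>"
    by (metis abs_ge_self abs_mult abs_numeral)
  \<comment> \<open>The quantity under \<open>max\<close> equals the larger of \<open>d2\<close> and
    \<open>- d1\<close>, so \<open>q\<close> measures the failure of \<open>d1\<close> to be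
    nonnegative and of \<open>d2\<close> to be nonpositive. Subtracting hypothesis \<open>d\<close>
    from hypothesis \<open>c\<close> bounds \<open>q\<close> together with
    \<open>\<bar>d3\<bar>\<close>.\<close>
  define q where "q = max 0 ((\<bar>d1 + d2\<bar> - (d1 - d2)) / 2)"
  have "(\<bar>d1 + d2\<bar> - (d1 - d2)) / 2 \<le> q" unfolding q_def by (rule max.cobounded2)
  then have q: "\<bar>d1 + d2\<bar> \<le> d1 - d2 + 2 * q" "0 \<le> q" by (simp_all add: field_simps) (simp add: q_def)
  have qr: "q + \<bar>d3\<bar> \<le> 1/3 - g"
  proof -
    have "\<bar>d3\<bar> \<le> 1/3 - g" "(\<bar>d1 + d2\<bar> - (d1 - d2)) / 2 + \<bar>d3\<bar> \<le> 1/3 - g"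
      using c d abs_triangle_ineq[of d1 d2] unfolding g_def by (argo, simp add: field_simps)
    then show ?thesis by (simp add: q_def max_def)
  qed
  have "2 * \<bar>d3\<bar> * \<bar>d1 + d2\<bar> \<le> 2 * \<bar>d3\<bar> * (d1 - d2 + 2 * q)"
    using q by (intro mult_left_mono) auto
  with D d3 have "disc c d1 d2 d3 \<le> g\<^sup>2 - (d1 - d2)\<^sup>2 + 2 * \<bar>d3\<bar> * (d1 - d2 + 2 * q) - d3\<^sup>2" by linarith
  also have "\<dots> = g\<^sup>2 - h\<^sup>2 + 4 * \<bar>d3\<bar> * q"
    unfolding h_def power2_abs[of d3, symmetric] by (simp add: power2_eq_square algebra_simps)
  also have "4 * \<bar>d3\<bar> * q \<le> (q + \<bar>d3\<bar>)\<^sup>2"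
    using zero_le_power2[of "q - \<bar>d3\<bar>"] by (simp add: power2_eq_square algebra_simps)
  also have "(q + \<bar>d3\<bar>)\<^sup>2 \<le> (1/3 - g)\<^sup>2" using qr q by (intro power_mono) auto
  finally have "disc c d1 d2 d3 \<le> g\<^sup>2 - (g - 1/6)\<^sup>2 + (1/3 - g)\<^sup>2" using hh by linarith
  also have "\<dots> = 1/12 - g * (1/3 - g)" by (simp add: power2_eq_square field_simps)
  also have "\<dots> \<le> 1/12" using g3 g4 by simp
  finally show ?thesis .
qed

text \<open>On two of the segments the midpoint values of \<open>lk\<close> are
  \<open>c + dk\<close> and \<open>c - dk\<close>, and an endpoint adds 1/2. So the maximum of
  \<open>lk\<close> is at least \<open>1/2 + c + \<bar>dk\<bar>\<close>, and
  \<open>heights_le_measure\<close> applies to the sum.\<close>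

lemma hex_config_heights:
  assumes H: "hex_config K c d1 d2 d3 t1 t2 t3"
  shows "3/2 + 3 * c + \<bar>d1\<bar> + \<bar>d2\<bar> + \<bar>d3\<bar> \<le> 3 * measure lebesgue K"
proof -
  note K = hex_configD(1,2)[OF H] and V = hex_configD(4-9)[OF H] and Q = hex_configD(10-12)[OF H]
  have ne: "K \<noteq> {}" using V by blast
  have cont: "continuous_on K (\<lambda>p. p $ i)" for i by (intro continuous_intros)
  obtain p1 where p1: "p1 \<in> K" "\<And>q. q \<in> K \<Longrightarrow> p1 $ 1 + p1 $ 2 \<le> q $ 1 + q $ 2"
    using continuous_attains_inf[OF K(1) ne continuous_on_add[OF cont cont]] by blast
  obtain p2 where p2: "p2 \<in> K" "\<And>q. q \<in> K \<Longrightarrow> q $ 1 \<le> p2 $ 1"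
    using continuous_attains_sup[OF K(1) ne cont] by blast
  obtain p3 where p3: "p3 \<in> K" "\<And>q. q \<in> K \<Longrightarrow> q $ 2 \<le> p3 $ 2"
    using continuous_attains_sup[OF K(1) ne cont] by blast
  have "- (p1 $ 1) - p1 $ 2 + p2 $ 1 + p3 $ 2 \<le> 3 * measure lebesgue K"
  proof (rule heights_le_measure[OF K, of "t2 + 2/9" "t3 + 2/9"])
    show "vector [p1 $ 1, p1 $ 2] \<in> K" "vector [p2 $ 1, p2 $ 2] \<in> K" "vector [p3 $ 1, p3 $ 2] \<in> K"
      using p1 p2 p3 by simp_all
    show "- u - v \<le> - p1 $ 1 - p1 $ 2" if "vector [u, v] \<in> K" for u v using p1(2)[OF that] by simp
    show "u \<le> p2 $ 1" if "vector [u, v] \<in> K" for u v using p2(2)[OF that] by simp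
    show "v \<le> p3 $ 2" if "vector [u, v] \<in> K" for u v using p3(2)[OF that] by simp
  qed (use Q in \<open>simp_all add: algebra_simps\<close>)
  moreover have "1/2 + c + \<bar>d1\<bar> \<le> - (p1 $ 1) - p1 $ 2"
    using p1(2)[OF V(5)] p1(2)[OF V(6)] by simp
  moreover have "1/2 + c + \<bar>d2\<bar> \<le> p2 $ 1" using p2(2)[OF V(1)] p2(2)[OF V(2)] by simp
  moreover have "1/2 + c + \<bar>d3\<bar> \<le> p3 $ 2" using p3(2)[OF V(3)] p3(2)[OF V(4)] by simp
  ultimately show ?thesis by linarith
qed

text \<open>Hypothesis \<open>t\<close> is the first condition of the nonagon bound. An area below
  2/3 forces the remaining conditions, after which the nonagon itself is too large.\<close>

lemma hex_config_area_aux: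
  assumes H: "hex_config K c d1 d2 d3 t1 t2 t3" and c: "0 \<le> c" and t: "t3 - 4/9 \<le> c + \<bar>d3\<bar> - 1/2"
  shows "2/3 \<le> measure lebesgue K"
proof (rule ccontr)
  assume "\<not> ?thesis"
  then have A: "measure lebesgue K < 2/3" by simp
  note K = hex_configD(1,2)[OF H] and V = hex_configD(4-9)[OF H] and Q = hex_configD(10-12)[OF H]
  define e where "e = \<bar>d1\<bar> + \<bar>d2\<bar> + \<bar>d3\<bar>"
  have s: "3 * c + e < 1/2" using hex_config_heights[OF H] A by (simp add: e_def)
  then have s': "3 * c + \<bar>d1\<bar> + \<bar>d2\<bar> + \<bar>d3\<bar> \<le> 1/2" by (simp add: e_def)
  have e0: "0 \<le> e" by (simp add: e_def)
  obtain v where v: "vector [v, c + \<bar>d3\<bar> + 1/2] \<in> K"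
    using V(3,4) by (cases "0 \<le> d3") auto
  obtain u where u: "vector [u, c - \<bar>d3\<bar> - 1/2] \<in> K"
    using V(1,6) by (cases "0 \<le> d3") auto
  have V2: "vector [c + d2 - 1/2 + 1, - 2 * c + d1 - d2] \<in> K" using V(2) by (simp add: algebra_simps)
  \<comment> \<open>The quadrilateral has the third segment as diagonal and the highest and lowest
    endpoints of the other segments as remaining vertices.\<close>
  have "(c + \<bar>d3\<bar> + 1/2) - (c - \<bar>d3\<bar> - 1/2) \<le> 2 * measure lebesgue K"
    using s' c by (intro width_le_measure[OF K V(5) V2 u v]) argo+
  with A have d3: "\<bar>d3\<bar> \<le> 1/6" by simp
  \<comment> \<open>If the upper side of the triangle is not above the third segment, the lowest
    triangle vertex is at least 2/3 below that segment and serves as the lower vertex of the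
    quadrilateral.\<close>
  have t3: "(c + \<bar>d3\<bar> + 1/2) - (t3 - 4/9) \<le> 2 * measure lebesgue K" if "t3 + 2/9 \<le> - 2 * c + d1 - d2"
    using s' c that by (intro width_le_measure[OF K V(5) V2 Q(3) v]) argo+
  have D: "1/12 < disc c d1 d2 d3"
    using hexagon_le_measure[OF H c s'] A by simp
  have ge: "e\<^sup>2 \<le> (1/2 - 3 * c)\<^sup>2" using s e0 by (intro power_mono) auto
  have D2: "disc c d1 d2 d3 \<le> 9 * c\<^sup>2 + (1/2 - 3 * c)\<^sup>2 / 3"
    using disc_le[of c d1 d2 d3] ge unfolding e_def by linarith
  \<comment> \<open>With \<open>g = 3 * c\<close>, the bounds \<open>D\<close> and \<open>D2\<close>
    combine to \<open>g * (4 * g - 1) > 0\<close>.\<close>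
  have g: "1/4 \<le> 3 * c"
  proof (rule ccontr)
    assume "\<not> 1/4 \<le> 3 * c"
    then have "c * (12 * c - 1) \<le> 0" using c by (intro mult_nonneg_nonpos) auto
    with D D2 show False by (simp add: power2_eq_square field_simps)
  qed
  have t': "- 2 * c + d1 - d2 \<le> t3 + 2/9"
  proof (rule ccontr)
    assume n: "\<not> - 2 * c + d1 - d2 \<le> t3 + 2/9"
    with t3 A have "3 * c - 1/6 \<le> d1 - d2 - \<bar>d3\<bar>" by argo
    from disc_small[OF s' g this] D show False by simp
  qed
  \<comment> \<open>The nonagon yields \<open>disc > 1/12 + c\<close>, while \<open>D2\<close>
    yields \<open>disc \<le> 1/12 - c + 12 * c\<^sup>2\<close>. These are incompatible for
    \<open>0 \<le> 6 * c \<le> 1\<close>.\<close>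
  have "17/24 - disc c d1 d2 d3 / 2 + c / 2 < 2/3"
    using nonagon_le_measure[OF H c s' t t' d3] A by simp
  moreover have "0 \<le> c * (1/2 - 3 * c)" using c s e0 by (intro mult_nonneg_nonneg) auto
  ultimately show False using D2 by (simp add: power2_eq_square field_simps)
qed

section \<open>Symmetries and normalization of configurations\<close>

definition lin2 :: "real \<Rightarrow> real \<Rightarrow> real \<Rightarrow> real \<Rightarrow> real^2 \<Rightarrow> real^2" where
  "lin2 a b c d p = vector [a * p$1 + b * p$2, c * p$1 + d * p$2]"

lemma lin2_vector [simp]: "lin2 a b c d (vector [x, y]) = vector [a * x + b * y, c * x + d * y]"
  by (simp add: lin2_def)

lemma linear_lin2: "linear (lin2 a b c d)"
  by (rule linearI) (simp_all add: lin2_def vec_eq_iff forall_2 algebra_simps)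

lemma measure_lin2:
  assumes "compact K"
  shows "measure lebesgue (lin2 a b c d ` K) = \<bar>a * d - b * c\<bar> * measure lebesgue K"
proof -
  have "det (matrix (lin2 a b c d)) = a * d - b * c"
    by (simp add: det_2 matrix_def lin2_def axis_def)
  then show ?thesis
    using measure_linear_image[OF linear_lin2 lmeasurable_compact[OF assms]] by simp
qed

lemma convex_compact_lin2:
  assumes "compact K" "convex K"
  shows "compact (lin2 a b c d ` K)" "convex (lin2 a b c d ` K)"
  using assms linear_lin2 by (simp_all add: compact_continuous_image linear_continuous_on linear_conv_bounded_linear convex_linear_image)

text \<open>The map of determinant 1 sends the coordinates (\<open>l2\<close>, \<open>l3\<close>) to
  (\<open>l3\<close>, \<open>l1\<close>), so it permutes the three functionals cyclically. Thus
  \<open>hex_config_area_aux\<close> becomes usable for every \<open>lk\<close>.\<close>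

lemma hex_config_rotate:
  assumes H: "hex_config K c d1 d2 d3 t1 t2 t3"
  shows "hex_config (lin2 0 1 (-1) (-1) ` K) c d2 d3 d1 t2 t3 t1"
    and "measure lebesgue (lin2 0 1 (-1) (-1) ` K) = measure lebesgue K"
proof -
  have t1: "t1 = - t2 - t3" using hex_configD(3)[OF H] by simp
  have im: "vector [y, - x - y] \<in> lin2 0 1 (-1) (-1) ` K" if "vector [x, y] \<in> K" for x y
    using imageI[OF that, of "lin2 0 1 (-1) (-1)"] by simp
  note V = hex_configD(4-12)[OF H, THEN im]
  show "hex_config (lin2 0 1 (-1) (-1) ` K) c d2 d3 d1 t2 t3 t1"
    unfolding hex_config_def t1 using V convex_compact_lin2[OF hex_configD(1,2)[OF H]]
    by (simp add: algebra_simps)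
  show "measure lebesgue (lin2 0 1 (-1) (-1) ` K) = measure lebesgue K"
    using measure_lin2[OF hex_configD(1)[OF H]] by simp
qed

lemma hex_config_area:
  assumes H: "hex_config K c d1 d2 d3 t1 t2 t3" and c: "0 \<le> c"
  shows "2/3 \<le> measure lebesgue K"
proof -
  note H' = hex_config_rotate(1)[OF H] and m' = hex_config_rotate(2)[OF H]
  note H'' = hex_config_rotate(1)[OF H'] and m'' = hex_config_rotate(2)[OF H']
  \<comment> \<open>If the condition on \<open>tk\<close> fails for all three indices, adding the
    failures and using that the \<open>tk\<close> sum to 0 gives the fourth case. There
    \<open>disc\<close> is so small that the hexagon suffices.\<close>
  consider "t3 - 4/9 \<le> c + \<bar>d3\<bar> - 1/2" | "t1 - 4/9 \<le> c + \<bar>d1\<bar> - 1/2" | "t2 - 4/9 \<le> c + \<bar>d2\<bar> - 1/2"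
    | "3 * c + \<bar>d1\<bar> + \<bar>d2\<bar> + \<bar>d3\<bar> \<le> 1/6"
    using hex_configD(3)[OF H] by argo
  then show ?thesis
  proof cases
    case 1
    then show ?thesis by (rule hex_config_area_aux[OF H c])
  next
    case 2
    then show ?thesis using hex_config_area_aux[OF H' c] m' by simp
  next
    case 3
    then show ?thesis using hex_config_area_aux[OF H'' c] m' m'' by simp
  next
    case 4
    have "(3 * c)\<^sup>2 \<le> (1/6)\<^sup>2" "(\<bar>d1\<bar> + \<bar>d2\<bar> + \<bar>d3\<bar>)\<^sup>2 \<le> (1/6)\<^sup>2"
      using 4 c by (intro power_mono; argo)+
    then have "disc c d1 d2 d3 \<le> 1/12"
      using disc_le[of c d1 d2 d3] by (simp add: power2_eq_square)
    moreover have "3/4 - disc c d1 d2 d3 \<le> measure lebesgue K"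
      using 4 by (intro hexagon_le_measure[OF H c]) linarith
    ultimately show ?thesis by simp
  qed
qed

text \<open>Translation by (\<open>p\<close>, \<open>q\<close>) equalizes the means required in
  \<open>hex_config\<close>. The value \<open>- 6 * c\<close> is the sum over k of the constant
  value of \<open>lk\<close> on the k-th segment, which translations preserve; \<open>pos\<close>
  says \<open>0 \<le> c\<close>. The shift by 2/9 passes from the right-angled vertex of the
  triangle to its centroid.\<close>

lemma cover_area_aux:
  assumes K: "compact K" "convex (K :: (real^2) set)"
    and s1: "vector [a1, b1] \<in> K" "vector [a1 + 1, b1 - 1] \<in> K"
    and s2: "vector [a2, b2] \<in> K" "vector [a2, b2 + 1] \<in> K"
    and s3: "vector [a3, b3] \<in> K" "vector [a3 - 1, b3] \<in> K"
    and T: "vector [x, y] \<in> K" "vector [x - 2/3, y] \<in> K" "vector [x, y - 2/3] \<in> K"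
    and pos: "a2 + b3 \<le> a1 + b1"
  shows "2/3 \<le> measure lebesgue K"
proof -
  define c where "c = (a1 + b1 - a2 - b3) / 6"
  define d1 where "d1 = (a3 + b3 - a2 - b2 - 1) / 2"
  define d2 where "d2 = (a3 - a1 - 1) / 2"
  define d3 where "d3 = (b1 - b2 - 1) / 2"
  define p where "p = c - (a1 + a3) / 2"
  define q where "q = c - (b1 + b2) / 2"
  let ?K = "(+) (vector [p, q]) ` K"
  have im: "vector [x, y] \<in> ?K" if "vector [x', y'] \<in> K" "x = p + x'" "y = q + y'" for x y x' y'
    using that by (intro image_eqI[OF _ that(1)]) (simp add: vec_eq_iff forall_2)
  have "hex_config ?K c d1 d2 d3 (- (x + p - 2/9) - (y + q - 2/9)) (x + p - 2/9) (y + q - 2/9)"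
    unfolding hex_config_def
  proof (intro conjI)
    show "compact ?K" "convex ?K" using K by (simp_all add: compact_translation convex_translation)
    show "vector [c - d2 + 1/2, c + d3 - 1/2] \<in> ?K"
      by (rule im[OF s1(2)]) (simp_all add: p_def q_def c_def d1_def d2_def d3_def field_simps)
    show "vector [c + d2 + 1/2, - 2 * c + d1 - d2] \<in> ?K"
      by (rule im[OF s3(1)]) (simp_all add: p_def q_def c_def d1_def d2_def d3_def field_simps)
    show "vector [- 2 * c + d3 - d1, c - d3 + 1/2] \<in> ?K"
      by (rule im[OF s2(2)]) (simp_all add: p_def q_def c_def d1_def d2_def d3_def field_simps)
    show "vector [c - d2 - 1/2, c + d3 + 1/2] \<in> ?K"
      by (rule im[OF s1(1)]) (simp_all add: p_def q_def c_def d1_def d2_def d3_def field_simps)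
    show "vector [c + d2 - 1/2, - 2 * c + d1 - d2] \<in> ?K"
      by (rule im[OF s3(2)]) (simp_all add: p_def q_def c_def d1_def d2_def d3_def field_simps)
    show "vector [- 2 * c + d3 - d1, c - d3 - 1/2] \<in> ?K"
      by (rule im[OF s2(1)]) (simp_all add: p_def q_def c_def d1_def d2_def d3_def field_simps)
    show "vector [x + p - 2/9 + 2/9, y + q - 2/9 + 2/9] \<in> ?K"
      by (rule im[OF T(1)]) (simp_all add: p_def q_def c_def d1_def d2_def d3_def field_simps)
    show "vector [x + p - 2/9 - 4/9, y + q - 2/9 + 2/9] \<in> ?K"
      by (rule im[OF T(2)]) (simp_all add: p_def q_def c_def d1_def d2_def d3_def field_simps)
    show "vector [x + p - 2/9 + 2/9, y + q - 2/9 - 4/9] \<in> ?K"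
      by (rule im[OF T(3)]) (simp_all add: p_def q_def c_def d1_def d2_def d3_def field_simps)
  qed simp
  from hex_config_area[OF this] pos have "2/3 \<le> measure lebesgue ?K" by (simp add: c_def)
  then show ?thesis by (simp add: measure_translation)
qed

text \<open>The point reflection changes the sign of \<open>c\<close> and exchanges the two opposite
  triangles, so one may assume \<open>0 \<le> c\<close>.\<close>

lemma cover_area:
  assumes K: "compact K" "convex (K :: (real^2) set)"
    and s1: "vector [a1, b1] \<in> K" "vector [a1 + 1, b1 - 1] \<in> K"
    and s2: "vector [a2, b2] \<in> K" "vector [a2, b2 + 1] \<in> K"
    and s3: "vector [a3, b3] \<in> K" "vector [a3 - 1, b3] \<in> K"
    and T: "vector [x, y] \<in> K" "vector [x - 2/3, y] \<in> K" "vector [x, y - 2/3] \<in> K"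
    and T': "vector [x', y'] \<in> K" "vector [x' + 2/3, y'] \<in> K" "vector [x', y' + 2/3] \<in> K"
  shows "2/3 \<le> measure lebesgue K"
proof (cases "a2 + b3 \<le> a1 + b1")
  case True
  then show ?thesis by (rule cover_area_aux[OF K s1 s2 s3 T])
next
  case False
  let ?K = "lin2 (-1) 0 0 (-1) ` K"
  have im: "vector [x, y] \<in> ?K" if "vector [- x, - y] \<in> K" for x y
    using imageI[OF that, of "lin2 (-1) 0 0 (-1)"] by simp
  have "2/3 \<le> measure lebesgue ?K"
    by (rule cover_area_aux[of _ "- a1 - 1" "1 - b1" "- a2" "- b2 - 1" "1 - a3" "- b3" "- x'" "- y'"])
      (use False convex_compact_lin2[OF K] s1 s2 s3 T' in \<open>auto intro!: im simp: algebra_simps\<close>)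
  then show ?thesis using measure_lin2[OF K(1)] by simp
qed

section \<open>The regular hexagon and the regular triangle\<close>

definition cis2 :: "real \<Rightarrow> real^2" where
  "cis2 t = vector [cos t, sin t]"

lemma inner_cis2: "cis2 s \<bullet> cis2 t = cos (s - t)"
  by (simp add: cis2_def inner_vec_def sum_2 cos_diff)

lemma cis2_add_pi: "cis2 (t + pi) = - cis2 t"
  by (simp add: cis2_def vec_eq_iff forall_2)

lemma cis2_periodic: "cis2 (t + 2 * pi) = cis2 t"
  by (simp add: cis2_def)

lemma cos_le_cos_pi_6:
  assumes "pi / 6 \<le> x" "x \<le> 11 * pi / 6"
  shows "cos x \<le> cos (pi / 6)"
proof (cases "x \<le> pi")
  case True
  then show ?thesis using assms by (intro cos_monotone_0_pi_le) auto
next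
  case False
  have "cos x = cos (2 * pi - x)" by simp
  also have "\<dots> \<le> cos (pi / 6)" using assms False by (intro cos_monotone_0_pi_le) auto
  finally show ?thesis .
qed

definition hexagon_vertex :: "real \<Rightarrow> nat \<Rightarrow> real^2" where
  "hexagon_vertex \<theta> k = (1 / sqrt 3) *\<^sub>R cis2 (\<theta> + real k * pi / 3)"

lemma hexagon_altdef: "hexagon \<theta> = convex hull (hexagon_vertex \<theta> ` {..<6})"
proof -
  have "vector [cos (\<theta> + real k * pi / 3) / sqrt 3, sin (\<theta> + real k * pi / 3) / sqrt 3] = hexagon_vertex \<theta> k" for k
    by (simp add: hexagon_vertex_def cis2_def vec_eq_iff forall_2)
  then show ?thesis unfolding hexagon_def by (intro arg_cong[of _ _ "(hull) convex"]) auto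
qed

text \<open>Index 6 is included because side \<open>j\<close> joins the vertices \<open>j\<close>
  and \<open>Suc j\<close>; for \<open>j = 5\<close> this wraps around to vertex 0.\<close>

lemma hexagon_vertex_in: "k \<le> 6 \<Longrightarrow> hexagon_vertex \<theta> k \<in> hexagon \<theta>"
proof -
  assume "k \<le> 6"
  have "hexagon_vertex \<theta> 6 = hexagon_vertex \<theta> 0"
    using cis2_periodic[of \<theta>] by (simp add: hexagon_vertex_def mult.commute)
  with \<open>k \<le> 6\<close> have "hexagon_vertex \<theta> k \<in> hexagon_vertex \<theta> ` {..<6}"
    by (cases "k = 6") auto
  then show ?thesis unfolding hexagon_altdef by (rule hull_inc)
qed

text \<open>The angle from \<open>d\<close> to each vertex is an odd multiple of
  \<open>pi / 6\<close>. The inner product is largest when its cosine is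
  \<open>cos (pi / 6)\<close>, which happens at the vertices \<open>j\<close> and
  \<open>Suc j\<close>. The value \<open>r / 2\<close> reflects the inradius 1/2.\<close>

lemma hexagon_side:
  fixes \<theta> r :: real and j :: nat
  assumes r: "0 < r" and j: "j < 6"
  defines "d \<equiv> r *\<^sub>R cis2 (\<theta> + pi / 6 + real j * pi / 3)"
  shows "Qnorm (hexagon \<theta>) d = r / 2" "side_normal (hexagon \<theta>) d"
proof -
  have val: "d \<bullet> hexagon_vertex \<theta> k = r / sqrt 3 * cos (pi / 6 + (real j - real k) * pi / 3)" for k
    unfolding d_def hexagon_vertex_def
    by (simp add: inner_cis2) (simp add: field_simps)
  have half: "r / sqrt 3 * cos (pi / 6) = r / 2"
    by (simp add: cos_30)
  have le: "d \<bullet> hexagon_vertex \<theta> k \<le> r / 2" if k: "k < 6" for k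
  proof -
    have "cos (pi / 6 + (real j - real k) * pi / 3) \<le> cos (pi / 6)"
    proof (cases "k \<le> j")
      case True
      then have "0 \<le> real j - real k" "real j - real k \<le> 5" using j by linarith+
      then have "0 \<le> (real j - real k) * pi" "(real j - real k) * pi \<le> 5 * pi" by (simp_all add: mult_right_mono)
      then show ?thesis by (intro cos_le_cos_pi_6) auto
    next
      case False
      then have "real k - real j \<ge> 1" "real k - real j \<le> 5" using k by linarith+
      then have "(real k - real j) * pi \<ge> 1 * pi" "(real k - real j) * pi \<le> 5 * pi" by (auto intro: mult_right_mono)
      then have "cos ((real k - real j) * pi / 3 - pi / 6) \<le> cos (pi / 6)"
        by (intro cos_le_cos_pi_6) simp_all
      also have "(real k - real j) * pi / 3 - pi / 6 = - (pi / 6 + (real j - real k) * pi / 3)"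
        by (simp add: field_simps)
      finally show ?thesis by (simp only: cos_minus)
    qed
    then have "r / sqrt 3 * cos (pi / 6 + (real j - real k) * pi / 3) \<le> r / sqrt 3 * cos (pi / 6)"
      using r by (intro mult_left_mono) auto
    then show ?thesis unfolding val by (simp only: half)
  qed
  have sub: "hexagon \<theta> \<subseteq> {y. d \<bullet> y \<le> r / 2}"
    unfolding hexagon_altdef using le by (intro hull_minimal convex_halfspace_le) auto
  have eq: "d \<bullet> hexagon_vertex \<theta> j = r / 2" using val[of j] half by simp
  have eq': "d \<bullet> hexagon_vertex \<theta> (Suc j) = r / 2"
  proof -
    have "pi / 6 + (real j - real (Suc j)) * pi / 3 = - (pi / 6)" by (simp add: field_simps)
    then show ?thesis using val[of "Suc j"] half by (simp only: cos_minus)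
  qed
  show Q: "Qnorm (hexagon \<theta>) d = r / 2"
    unfolding Qnorm_def using sub eq hexagon_vertex_in[of j \<theta>] j
    by (intro cSup_eq_maximum) (auto intro!: image_eqI[of _ _ "hexagon_vertex \<theta> j"])
  have d0: "d \<noteq> 0" using eq r by auto
  have ne: "hexagon_vertex \<theta> j \<noteq> hexagon_vertex \<theta> (Suc j)"
  proof
    assume "hexagon_vertex \<theta> j = hexagon_vertex \<theta> (Suc j)"
    then have "cis2 (\<theta> + real j * pi / 3) = cis2 (\<theta> + real (Suc j) * pi / 3)" by (simp add: hexagon_vertex_def)
    then have "cis2 (\<theta> + real j * pi / 3) \<bullet> cis2 (\<theta> + real j * pi / 3) = cis2 (\<theta> + real (Suc j) * pi / 3) \<bullet> cis2 (\<theta> + real j * pi / 3)"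
      by simp
    then have "1 = cos (\<theta> + real (Suc j) * pi / 3 - (\<theta> + real j * pi / 3))" by (simp add: inner_cis2)
    also have "\<theta> + real (Suc j) * pi / 3 - (\<theta> + real j * pi / 3) = pi / 3" by (simp add: field_simps)
    finally show False by (simp add: cos_60)
  qed
  let ?F = "{y \<in> hexagon \<theta>. d \<bullet> y = Qnorm (hexagon \<theta>) d}"
  have "aff_dim {hexagon_vertex \<theta> j, hexagon_vertex \<theta> (Suc j)} \<le> aff_dim ?F"
    using eq eq' Q hexagon_vertex_in[of j \<theta>] hexagon_vertex_in[of "Suc j" \<theta>] j by (intro aff_dim_subset) auto
  then have "1 \<le> aff_dim ?F" using ne by (simp add: aff_dim_2)
  moreover have "aff_dim ?F \<le> aff_dim {y. d \<bullet> y = r / 2}" using Q by (intro aff_dim_subset) auto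
  then have "aff_dim ?F \<le> 1" unfolding aff_dim_hyperplane[OF d0] by simp
  ultimately show "side_normal (hexagon \<theta>) d" using d0 unfolding side_normal_def by simp
qed

section \<open>Areas of the regular triangle and the regular hexagon\<close>

lemma sin_cos_3: "cos (2 * pi / 3) = - 1 / 2" "sin (2 * pi / 3) = sqrt 3 / 2"
  "cos (4 * pi / 3) = - 1 / 2" "sin (4 * pi / 3) = - sqrt 3 / 2"
proof -
  have *: "2 * pi / 3 = pi - pi / 3" "4 * pi / 3 = pi / 3 + pi" by simp_all
  show "cos (2 * pi / 3) = - 1 / 2" "sin (2 * pi / 3) = sqrt 3 / 2"
    "cos (4 * pi / 3) = - 1 / 2" "sin (4 * pi / 3) = - sqrt 3 / 2"
    unfolding * by (simp_all only: cos_periodic_pi sin_periodic_pi cos_pi_minus sin_pi_minus cos_60 sin_60)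
qed

lemma measure_triangle0: "measure lebesgue (triangle0 \<theta>) = 1 / sqrt 3"
proof -
  define a where "a = \<theta> - pi / 6"
  define c s where "c = cos a" and "s = sin a"
  have cs: "c * c + s * s = 1" using sin_cos_squared_add[of a] by (simp add: c_def s_def power2_eq_square)
  define f where "f k = (vector [2/3 * cos (a + real k * 2 * pi / 3), 2/3 * sin (a + real k * 2 * pi / 3)] :: real^2)" for k :: nat
  have "triangle0 \<theta> = convex hull (f ` {..<3})"
    unfolding triangle0_def f_def a_def by (intro arg_cong[of _ _ "(hull) convex"]) auto
  also have "f ` {..<3} = {f 0, f 1, f 2}" by (simp add: lessThan_Suc eval_nat_numeral) auto
  finally have T: "triangle0 \<theta> = convex hull {f 0, f 1, f 2}" .
  have f0: "f 0 = vector [2/3 * c, 2/3 * s]" by (simp add: f_def c_def s_def)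
  have f1: "f 1 = vector [2/3 * (- c / 2 - s * sqrt 3 / 2), 2/3 * (- s / 2 + c * sqrt 3 / 2)]"
    by (simp add: f_def c_def s_def cos_add sin_add sin_cos_3)
  have f2: "f 2 = vector [2/3 * (- c / 2 + s * sqrt 3 / 2), 2/3 * (- s / 2 - c * sqrt 3 / 2)]"
    by (simp add: f_def c_def s_def cos_add sin_add sin_cos_3)
  have "measure lebesgue (triangle0 \<theta>) = measure lborel (triangle0 \<theta>)"
    unfolding T by (intro measure_completion) (simp add: borel_compact compact_convex_hull)
  also have "\<dots> = sqrt 3 / 3"
  proof -
    \<comment> \<open>The terms quadratic in \<open>r\<close> cancel, so the identity needs no
      property of \<open>sqrt 3\<close>.\<close>
    have "(2 / 3 * (- c / 2 + s * r / 2) - 2 / 3 * c) * (2 / 3 * (- s / 2 + c * r / 2) - 2 / 3 * s) -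
      (2 / 3 * (- c / 2 - s * r / 2) - 2 / 3 * c) * (2 / 3 * (- s / 2 - c * r / 2) - 2 / 3 * s) =
      - (2 * r / 3) * (c * c + s * s)" for r by (simp add: field_simps)
    then show ?thesis unfolding T content_triangle f0 f1 f2 vector_2 cs by simp
  qed
  also have "\<dots> = 1 / sqrt 3" by (simp add: field_simps)
  finally show ?thesis .
qed

text \<open>The lower bound is the signed boundary polygon. For the upper bound the hexagon is
  covered by two unit squares and two right triangles of area 1/2, one in each quadrant.\<close>

lemma measure_unit_hexagon:
  defines "H \<equiv> convex hull {vector [1, 0], vector [0, 1], vector [-1, 1], vector [-1, 0], vector [0, -1], vector [1, -1] :: real^2}"
  shows "measure lebesgue H = 3"
proof -
  have cH: "compact H" "convex H" unfolding H_def by (simp_all add: compact_convex_hull finite_imp_compact)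
  show ?thesis
  proof (rule antisym)
    have V: "vector [1, 0] \<in> H" "vector [0, 1] \<in> H" "vector [-1, 1] \<in> H" "vector [-1, 0] \<in> H" "vector [0, -1] \<in> H" "vector [1, -1] \<in> H"
      unfolding H_def by (simp_all add: hull_inc)
    obtain F G where FG: "chain_potentials H F G" using chain_potentials_exist[OF cH] by blast
    note F = trap_right[OF FG] and G = trap_left[OF FG] and A = chain_measure[OF FG]
    have "trap 0 (-1) 1 (-1) + trap 1 (-1) 1 0 + trap 1 0 0 1 + trap 0 1 (-1) 1 + trap (-1) 1 (-1) 0 + trap (-1) 0 0 (-1) \<le> 2 * measure lebesgue H"
      using F[OF V(5,6)] F[OF V(6,1)] F[OF V(1,2)] G[OF V(2,3)] G[OF V(3,4)] G[OF V(4,5)] A[OF V(5,2)] by simp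
    then show "3 \<le> measure lebesgue H" by (simp add: trap_def)
  next
    let ?A = "cbox (vector [0, -1]) (vector [1, 0]) :: (real^2) set"
    let ?B = "cbox (vector [-1, 0]) (vector [0, 1]) :: (real^2) set"
    let ?C = "convex hull {0, vector [1, 0], vector [0, 1]} :: (real^2) set"
    let ?D = "convex hull {0, vector [-1, 0], vector [0, -1]} :: (real^2) set"
    let ?S = "{p :: real^2. \<bar>p$1\<bar> \<le> 1 \<and> \<bar>p$2\<bar> \<le> 1 \<and> \<bar>p$1 + p$2\<bar> \<le> 1}"
    have "convex ?S"
    proof -
      have "?S = {p. axis 1 1 \<bullet> p \<le> 1} \<inter> {p. axis 1 1 \<bullet> p \<ge> -1} \<inter> {p. axis 2 1 \<bullet> p \<le> 1} \<inter> {p. axis 2 1 \<bullet> p \<ge> -1}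
         \<inter> {p. vector [1, 1] \<bullet> p \<le> 1} \<inter> {p. vector [1, 1] \<bullet> p \<ge> -1}"
        by (auto simp: inner_vec_def sum_2 axis_def abs_le_iff)
      then show ?thesis by (auto intro!: convex_Int convex_halfspace_le convex_halfspace_ge)
    qed
    then have "H \<subseteq> ?S" unfolding H_def by (intro hull_minimal) auto
    also have "?S \<subseteq> (?A \<union> ?B) \<union> (?C \<union> ?D)"
    proof
      fix p assume p: "p \<in> ?S"
      consider "0 \<le> p$1" "p$2 \<le> 0" | "p$1 \<le> 0" "0 \<le> p$2" | "0 \<le> p$1" "0 \<le> p$2" | "p$1 \<le> 0" "p$2 \<le> 0" by linarith
      then show "p \<in> (?A \<union> ?B) \<union> (?C \<union> ?D)"
      proof cases
        case 1
        then have "p \<in> ?A" using p by (simp add: mem_box_cart forall_2)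
        then show ?thesis by blast
      next
        case 2
        then have "p \<in> ?B" using p by (simp add: mem_box_cart forall_2)
        then show ?thesis by blast
      next
        case 3
        have "p = (1 - p$1 - p$2) *\<^sub>R 0 + p$1 *\<^sub>R vector [1, 0] + p$2 *\<^sub>R vector [0, 1]"
          by (simp add: vec_eq_iff forall_2)
        moreover have "0 \<le> 1 - p$1 - p$2" using p by auto
        ultimately have "p \<in> ?C" using 3 unfolding convex_hull_3 by (intro CollectI exI[of _ "1 - p$1 - p$2"] exI[of _ "p$1"] exI[of _ "p$2"]) simp
        then show ?thesis by blast
      next
        case 4
        have "p = (1 + p$1 + p$2) *\<^sub>R 0 + (- p$1) *\<^sub>R vector [-1, 0] + (- p$2) *\<^sub>R vector [0, -1]"
          by (simp add: vec_eq_iff forall_2)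
        moreover have "0 \<le> 1 + p$1 + p$2" using p by auto
        ultimately have "p \<in> ?D" using 4 unfolding convex_hull_3 by (intro CollectI exI[of _ "1 + p$1 + p$2"] exI[of _ "- p$1"] exI[of _ "- p$2"]) simp
        then show ?thesis by blast
      qed
    qed
    finally have sub: "H \<subseteq> (?A \<union> ?B) \<union> (?C \<union> ?D)" .
    have mA: "?A \<in> lmeasurable" "?B \<in> lmeasurable" "?C \<in> lmeasurable" "?D \<in> lmeasurable"
      by (simp_all add: lmeasurable_compact compact_convex_hull finite_imp_compact)
    have "measure lebesgue ?A = 1" "measure lebesgue ?B = 1"
      using content_cbox_cart[of "vector [0, -1] :: real^2" "vector [1, 0]"] content_cbox_cart[of "vector [-1, 0] :: real^2" "vector [0, 1]"]
      by (simp_all add: interval_eq_empty_cart not_less forall_2 UNIV_2)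
    moreover have "measure lebesgue ?C = 1/2" "measure lebesgue ?D = 1/2"
      using content_triangle[of 0 "vector [1, 0]" "vector [0, 1]"] content_triangle[of 0 "vector [-1, 0]" "vector [0, -1]"]
      by (simp_all add: measure_completion borel_compact compact_convex_hull finite_imp_compact)
    moreover have "measure lebesgue H \<le> measure lebesgue ((?A \<union> ?B) \<union> (?C \<union> ?D))"
      using sub mA fmeasurableD[OF lmeasurable_compact[OF cH(1)]]
      by (intro measure_mono_fmeasurable) (auto intro: fmeasurable.Un)
    moreover have "measure lebesgue ((?A \<union> ?B) \<union> (?C \<union> ?D)) \<le> (measure lebesgue ?A + measure lebesgue ?B) + (measure lebesgue ?C + measure lebesgue ?D)"
      using mA by (intro order_trans[OF measure_Un_le] add_mono measure_Un_le) (auto dest: fmeasurableD)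
    ultimately show "measure lebesgue H \<le> 3" by linarith
  qed
qed

text \<open>The linear map sending the two unit vectors to adjacent vertices carries the hexagon of
  \<open>measure_unit_hexagon\<close> onto this one, since every vertex is the difference of its two
  neighbours in suitable order or the negative of another vertex.\<close>

lemma measure_hexagon: "measure lebesgue (hexagon \<theta>) = sqrt 3 / 2"
proof -
  let ?H = "convex hull {vector [1, 0], vector [0, 1], vector [-1, 1], vector [-1, 0], vector [0, -1], vector [1, -1] :: real^2}"
  let ?v = "hexagon_vertex \<theta>"
  define L where "L = lin2 (?v 0 $ 1) (?v 1 $ 1) (?v 0 $ 2) (?v 1 $ 2)"
  have L: "L (vector [x, y]) = x *\<^sub>R ?v 0 + y *\<^sub>R ?v 1" for x y
    by (simp add: L_def vec_eq_iff forall_2)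
  have opp: "?v (k + 3) = - ?v k" for k
    using cis2_add_pi[of "\<theta> + real k * pi / 3"] by (simp add: hexagon_vertex_def algebra_simps add_divide_distrib)
  have v2: "?v 2 = ?v 1 - ?v 0"
    by (simp add: hexagon_vertex_def cis2_def vec_eq_iff forall_2 cos_add sin_add sin_cos_3 cos_60 sin_60)
      (simp add: field_simps)
  have "hexagon \<theta> = convex hull (L ` {vector [1, 0], vector [0, 1], vector [-1, 1], vector [-1, 0], vector [0, -1], vector [1, -1]})"
    unfolding hexagon_altdef
    using opp[of 0] opp[of 1] opp[of 2] v2
    by (simp add: L lessThan_Suc eval_nat_numeral insert_commute)
  also have "\<dots> = L ` ?H" using linear_lin2 unfolding L_def by (simp add: convex_hull_linear_image)
  finally have "measure lebesgue (hexagon \<theta>) = \<bar>?v 0 $ 1 * ?v 1 $ 2 - ?v 1 $ 1 * ?v 0 $ 2\<bar> * 3"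
    unfolding L_def by (simp add: measure_lin2 measure_unit_hexagon compact_convex_hull finite_imp_compact)
  also have "?v 0 $ 1 * ?v 1 $ 2 - ?v 1 $ 1 * ?v 0 $ 2 = sin ((\<theta> + pi / 3) - \<theta>) / 3"
    unfolding sin_diff by (simp add: hexagon_vertex_def cis2_def field_simps)
  finally show ?thesis by (simp add: sin_60)
qed

section \<open>Affine coordinates for a cover\<close>

lemma lin2_inverse:
  assumes "a * d - b * c \<noteq> 0"
  defines "e \<equiv> a * d - b * c"
  shows "lin2 (d / e) (- b / e) (- c / e) (a / e) (lin2 a b c d p) = p"
proof -
  have e: "e \<noteq> 0" using assms by simp
  have "d * (a * p$1 + b * p$2) - b * (c * p$1 + d * p$2) = e * p$1"
    "a * (c * p$1 + d * p$2) - c * (a * p$1 + b * p$2) = e * p$2"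
    by (simp_all add: e_def algebra_simps)
  moreover have "u / e * x + - v / e * y = (u * x - v * y) / e" "- v / e * y + u / e * x = (u * x - v * y) / e" for u v x y
    by (simp_all add: diff_divide_distrib)
  ultimately show ?thesis using e by (simp add: lin2_def vec_eq_iff forall_2)
qed

lemma not_collinear_lin2:
  assumes "a * d - b * c \<noteq> 0" "x \<noteq> 0" "y \<noteq> 0"
  shows "\<not> collinear {0, lin2 a b c d (vector [x, 0]), lin2 a b c d (vector [0, y])}"
proof
  assume *: "collinear {0, lin2 a b c d (vector [x, 0]), lin2 a b c d (vector [0, y])}"
  have inj: "lin2 a b c d p = lin2 a b c d q \<Longrightarrow> p = q" for p q
    using lin2_inverse[OF assms(1)] by metis
  have z: "lin2 a b c d 0 = 0" by (rule linear_0[OF linear_lin2])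
  have "lin2 a b c d (vector [x, 0]) \<noteq> 0" "lin2 a b c d (vector [0, y]) \<noteq> 0"
    using inj[of "vector [x, 0]" 0] inj[of "vector [0, y]" 0] z assms(2,3) by (auto simp: vec_eq_iff forall_2)
  with * obtain k where "lin2 a b c d (vector [0, y]) = k *\<^sub>R lin2 a b c d (vector [x, 0])"
    unfolding collinear_lemma by blast
  then have "lin2 a b c d (vector [0, y]) = lin2 a b c d (k *\<^sub>R vector [x, 0])"
    by (simp add: linear_scale[OF linear_lin2])
  from inj[OF this] assms(3) show False by (simp add: vec_eq_iff forall_2)
qed

text \<open>A vector of length \<open>r\<close> normal to a side has \<open>Qnorm\<close> equal to
  \<open>r / 2\<close>. Hence normal segments have length 1 and normal equilateral triangles have
  side 2/3, which are the lengths in \<open>cover_area\<close> after inverting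
  \<open>L\<close>.\<close>

lemma Q_cover_area:
  assumes "Q_cover (hexagon \<theta>) K"
  shows "1 / sqrt 3 \<le> measure lebesgue K"
proof -
  have K: "compact K" "convex K" and fit: "\<And>T. Q_normal_triangle (hexagon \<theta>) T \<or> Q_normal_segment (hexagon \<theta>) T \<Longrightarrow> fits_into T K"
    using assms unfolding Q_cover_def by blast+
  \<comment> \<open>\<open>D2\<close>, \<open>D3\<close> and \<open>- D2 - D3\<close> are unit side
    normals at mutual angles of 120 degrees. \<open>L\<close> sends (0,1), (-1,0) and (1,-1) to
    them, and the opposite vectors to the other three normals.\<close>
  define D2 D3 where "D2 = cis2 (\<theta> + pi / 6 + 2 * pi / 3)" and "D3 = cis2 (\<theta> + pi / 6 + 4 * pi / 3)"
  define a b c d where "a = - D3 $ 1" and "b = D2 $ 1" and "c = - D3 $ 2" and "d = D2 $ 2"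
  define L where "L = lin2 a b c d"
  have e: "a * d - b * c = sqrt 3 / 2"
  proof -
    have "a * d - b * c = sin ((\<theta> + pi / 6 + 4 * pi / 3) - (\<theta> + pi / 6 + 2 * pi / 3))"
      unfolding sin_diff by (simp add: a_def b_def c_def d_def D2_def D3_def cis2_def algebra_simps)
    also have "(\<theta> + pi / 6 + 4 * pi / 3) - (\<theta> + pi / 6 + 2 * pi / 3) = 2 * pi / 3" by simp
    finally show ?thesis by (simp add: sin_cos_3)
  qed
  have e0: "a * d - b * c \<noteq> 0" unfolding e by simp
  have L: "L (vector [x, y]) = - x *\<^sub>R D3 + y *\<^sub>R D2" for x y
    by (simp add: L_def a_def b_def c_def d_def vec_eq_iff forall_2)
  have sides: "side_normal (hexagon \<theta>) (r *\<^sub>R L v) \<and> Qnorm (hexagon \<theta>) (r *\<^sub>R L v) = r / 2"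
    if r: "0 < r" and v: "v \<in> {vector [1, -1], vector [0, 1], vector [-1, 0], vector [-1, 1], vector [0, -1], vector [1, 0]}" for r v
  proof -
    define \<phi> where "\<phi> = \<theta> + pi / 6"
    have D1: "- D2 - D3 = cis2 \<phi>"
      by (simp add: D2_def D3_def cis2_def vec_eq_iff forall_2 cos_add[of \<phi>] sin_add[of \<phi>] sin_cos_3 flip: \<phi>_def)
    have D23: "D2 = cis2 (\<phi> + 2 * pi / 3)" "D3 = cis2 (\<phi> + 4 * pi / 3)" by (simp_all add: D2_def D3_def \<phi>_def)
    have D4: "- cis2 \<phi> = cis2 (\<phi> + 3 * pi / 3)" "- D2 = cis2 (\<phi> + 5 * pi / 3)"
      using cis2_add_pi[of \<phi>] cis2_add_pi[of "\<phi> + 2 * pi / 3"] by (simp_all add: D23 add.assoc)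
    have D5: "- D3 = cis2 (\<phi> + pi / 3)"
      using cis2_add_pi[of "\<phi> + pi / 3"] by (simp add: D23 add.assoc)
    have Lv: "L (vector [1, -1]) = - D2 - D3" "L (vector [1, 0]) = - D3" "L (vector [0, 1]) = D2"
      "L (vector [-1, 1]) = - (- D2 - D3)" "L (vector [-1, 0]) = D3" "L (vector [0, -1]) = - D2"
      by (simp_all add: L)
    have "L (vector [1, -1]) = cis2 (\<phi> + real 0 * pi / 3)" "L (vector [1, 0]) = cis2 (\<phi> + real 1 * pi / 3)"
      "L (vector [0, 1]) = cis2 (\<phi> + real 2 * pi / 3)" "L (vector [-1, 1]) = cis2 (\<phi> + real 3 * pi / 3)"
      "L (vector [-1, 0]) = cis2 (\<phi> + real 4 * pi / 3)" "L (vector [0, -1]) = cis2 (\<phi> + real 5 * pi / 3)"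
      unfolding Lv unfolding D1 unfolding D4 D5 by (simp_all add: D23)
    moreover have "0 < (6::nat)" "1 < (6::nat)" "2 < (6::nat)" "3 < (6::nat)" "4 < (6::nat)" "5 < (6::nat)" by simp_all
    ultimately have "\<exists>j<6. L v = cis2 (\<theta> + pi / 6 + real j * pi / 3)"
      using v unfolding \<phi>_def[symmetric] by (elim insertE emptyE) metis+
    then show ?thesis using hexagon_side[OF r] by metis
  qed
  define L' where "L' = lin2 (d / (a * d - b * c)) (- b / (a * d - b * c)) (- c / (a * d - b * c)) (a / (a * d - b * c))"
  have L'L: "L' (L p) = p" for p unfolding L'_def L_def by (rule lin2_inverse[OF e0])
  have lin: "linear L" "linear L'" unfolding L_def L'_def by (rule linear_lin2)+
  let ?K = "L' ` K"
  have K': "compact ?K" "convex ?K" unfolding L'_def by (rule convex_compact_lin2[OF K])+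
  have place: "\<exists>x y. \<forall>v\<in>V. vector [x + v$1, y + v$2] \<in> ?K" if "fits_into T K" "L ` V \<subseteq> T" for T V
  proof -
    obtain t where t: "(\<lambda>x. x + t) ` T \<subseteq> K" using \<open>fits_into T K\<close> unfolding fits_into_def by blast
    have "vector [L' t $ 1 + v$1, L' t $ 2 + v$2] \<in> ?K" if "v \<in> V" for v
    proof -
      have "L v + t \<in> K" using t \<open>L ` V \<subseteq> T\<close> that by blast
      then have "L' (L v + t) \<in> ?K" by (rule imageI)
      also have "L' (L v + t) = v + L' t" by (simp add: linear_add[OF lin(2)] L'L)
      also have "\<dots> = vector [L' t $ 1 + v$1, L' t $ 2 + v$2]" by (simp add: vec_eq_iff forall_2)
      finally show ?thesis .
    qed
    then show ?thesis by blast
  qed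
  have seg: "\<exists>x y. \<forall>w\<in>{0, v}. vector [x + w$1, y + w$2] \<in> ?K" if v: "v \<in> {vector [1, -1], vector [0, 1], vector [-1, 0]}" for v :: "real^2"
  proof (rule place)
    have "- v \<in> {vector [-1, 1], vector [0, -1], vector [1, 0]}" using v by (auto simp: vec_eq_iff forall_2)
    then have "side_normal (hexagon \<theta>) (1 *\<^sub>R L v) \<and> Qnorm (hexagon \<theta>) (1 *\<^sub>R L v) = 1 / 2"
      "side_normal (hexagon \<theta>) (1 *\<^sub>R L (- v)) \<and> Qnorm (hexagon \<theta>) (1 *\<^sub>R L (- v)) = 1 / 2"
      using v sides[OF zero_less_one, of v] sides[OF zero_less_one, of "- v"] by blast+
    then have "Q_normal_segment (hexagon \<theta>) (closed_segment 0 (L v))"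
      unfolding Q_normal_segment_def by (intro exI[of _ 0] exI[of _ "L v"]) (simp add: linear_neg[OF lin(1)])
    then show "fits_into (closed_segment 0 (L v)) K" using fit by blast
    show "L ` {0, v} \<subseteq> closed_segment 0 (L v)" by (simp add: linear_0[OF lin(1)])
  qed
  \<comment> \<open>The sign \<open>s\<close> selects one of the two opposite triangles. Each side
    contributes \<open>(2/3) / 2 = 1/3\<close> to the perimeter, giving total 1.\<close>
  have tri: "\<exists>x y. \<forall>w\<in>{0, vector [s * 2/3, 0], vector [0, s * 2/3] :: real^2}. vector [x + w$1, y + w$2] \<in> ?K" if s: "s = 1 \<or> s = -1" for s :: real
  proof (rule place)
    let ?v = "L (vector [s * 2/3, 0])" and ?w = "L (vector [0, s * 2/3])"
    have v: "?v - 0 = (2/3) *\<^sub>R L (vector [s, 0])" "?w - ?v = (2/3) *\<^sub>R L (vector [-s, s])" "0 - ?w = (2/3) *\<^sub>R L (vector [0, -s])"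
      by (simp_all add: L algebra_simps)
    have S: "side_normal (hexagon \<theta>) ((2/3) *\<^sub>R L u) \<and> Qnorm (hexagon \<theta>) ((2/3) *\<^sub>R L u) = (2/3) / 2"
      if "u \<in> {vector [s, 0], vector [-s, s], vector [0, -s]}" for u
      using s that by (intro sides) auto
    have "\<not> collinear {0, ?v, ?w}" unfolding L_def using s by (intro not_collinear_lin2[OF e0]) auto
    then have "Q_normal_triangle (hexagon \<theta>) (convex hull {0, ?v, ?w})"
      unfolding Q_normal_triangle_def
      by (intro exI[of _ 0] exI[of _ ?v] exI[of _ ?w]) (simp only: v S insertI1 insertI2, simp)
    then show "fits_into (convex hull {0, ?v, ?w}) K" using fit by blast
    show "L ` {0, vector [s * 2/3, 0], vector [0, s * 2/3]} \<subseteq> convex hull {0, ?v, ?w}"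
      by (simp add: linear_0[OF lin(1)] hull_inc)
  qed
  obtain a1 b1 where s1: "vector [a1, b1] \<in> ?K" "vector [a1 + 1, b1 - 1] \<in> ?K"
    using seg[of "vector [1, -1]"] by auto
  obtain a2 b2 where s2: "vector [a2, b2] \<in> ?K" "vector [a2, b2 + 1] \<in> ?K"
    using seg[of "vector [0, 1]"] by auto
  obtain a3 b3 where s3: "vector [a3, b3] \<in> ?K" "vector [a3 - 1, b3] \<in> ?K"
    using seg[of "vector [-1, 0]"] by auto
  obtain x y where T: "vector [x, y] \<in> ?K" "vector [x - 2/3, y] \<in> ?K" "vector [x, y - 2/3] \<in> ?K"
    using tri[of "-1"] by auto
  obtain x' y' where T': "vector [x', y'] \<in> ?K" "vector [x' + 2/3, y'] \<in> ?K" "vector [x', y' + 2/3] \<in> ?K"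
    using tri[of 1] by auto
  have "2/3 \<le> measure lebesgue ?K" by (rule cover_area[OF K' s1 s2 s3 T T'])
  also have "measure lebesgue ?K = 2 / sqrt 3 * measure lebesgue K"
  proof -
    \<comment> \<open>This is the determinant of \<open>L'\<close>, the reciprocal of the
      determinant \<open>sqrt 3 / 2\<close> of \<open>L\<close>.\<close>
    have "d / (a * d - b * c) * (a / (a * d - b * c)) - (- b / (a * d - b * c)) * (- c / (a * d - b * c)) = (a * d - b * c) / (a * d - b * c)\<^sup>2"
      by (simp add: power2_eq_square diff_divide_distrib mult.commute)
    also have "\<dots> = 2 / sqrt 3" unfolding e by (simp add: power2_eq_square field_simps)
    finally show ?thesis unfolding L'_def by (subst measure_lin2[OF K(1)]) simp
  qed
  finally have "sqrt 3 / 3 \<le> measure lebesgue K" by (simp add: field_simps)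
  also have "sqrt 3 / 3 = 1 / sqrt 3" by (simp add: field_simps)
  finally show ?thesis .
qed

theorem theorem7p2:
  fixes \<theta> :: real and K :: "(real^2) set"
  assumes "Q_cover (hexagon \<theta>) K"
  shows "measure lebesgue K \<ge> measure lebesgue (triangle0 \<theta>)
       \<and> measure lebesgue (triangle0 \<theta>) = 1 / (2 * measure lebesgue (hexagon \<theta>))"
  using Q_cover_area[OF assms] by (simp add: measure_triangle0 measure_hexagon)

end
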